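(* Let $\{x^k\}$ be generated by the algorithm PGiPN described in the context with $\epsilon=0$, assume $x^k\ne\bar x^k$ for all $k$, let $\Gamma(x^0)$ be the set of accumulation points of $\{x^k\}$, let $\Pi_*$ be the eventual common value of $\Pi(x^k)$ (see context), and let $\phi=f+\delta_{\Pi_*}$. Assume: (A1) $\nabla^2f$ is locally Lipschitz continuous on an open set containing $\Gamma(x^0)$; (A2) $0\in\nabla f(x^* )+\mathrm{ri}(\mathcal{N}_{\Pi_*}(x^* ))$ for all $x^*\in\Gamma(x^0)$; (A3) for every sufficiently large $k$ there is $\xi_k\in\mathcal{N}_{\Pi_*}(x^k)$ such that $\liminf_{k\to\infty}\frac{-\langle\nabla f(x^k)+\xi_k,d^k\rangle}{\|\nabla f(x^k)+\xi_k\|\|d^k\|}>0$; and assume $\phi$ is a KL function. Then $\sum_{k=1}^\infty\|x^{k+1}-x^k\|<\infty$, and consequently $\{x^k\}$ converges to an $L$-stationary point of $\min_x F(x)$.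
   Context: Setting: $B\in\mathbb{R}^{p\times n}$, $\lambda_1,\lambda_2>0$, $l\le0\le u$ in $\mathbb{R}^n$, $f:\mathbb{R}^n\to\mathbb{R}$ twice continuously differentiable, $\Omega=\{x:l\le x\le u\}$, $g(x)=\lambda_1\|Bx\|_0+\lambda_2\|x\|_0+\delta_\Omega(x)$ ($\|\cdot\|_0$ = number of nonzeros, $\delta_C$ indicator of $C$), $F=f+g$; $\mathrm{supp}(x)=\{i:x_i\ne0\}$; $\mathrm{prox}_{\mu g}(z)=\arg\min_x\{\frac1{2\mu}\|x-z\|^2+g(x)\}$; $\Pi(z)=\{x\in\Omega:\mathrm{supp}(x)\subset\mathrm{supp}(z),\mathrm{supp}(Bx)\subset\mathrm{supp}(Bz)\}$; $\mathcal{N}_C$ is the normal cone and $\mathrm{ri}$ the relative interior. A point $x$ is $L$-stationary for $\min F$ if $x\in\mathrm{prox}_{\mu^{-1}g}(x-\mu^{-1}\nabla f(x))$ for some $\mu>0$. KL property: for $\eta>0$ let $\Upsilon_\eta$ be the set of continuous concave $\varphi:[0,\eta)\to\mathbb{R}_+$, continuously differentiable on $(0,\eta)$, with $\varphi(0)=0$ and $\varphi'>0$ on $(0,\eta)$. A proper $h$ has the KL property at $\bar x\in\mathrm{dom}\,\partial h$ if there are $\eta\in(0,\infty]$, a neighborhood $\mathcal U$ of $\bar x$ and $\varphi\in\Upsilon_\eta$ with $\varphi'(h(x)-h(\bar x))\,\mathrm{dist}(0,\partial h(x))\ge1$ for all $x\in\mathcal U$ with $h(\bar x)<h(x)<h(\bar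 x)+\eta$; $h$ is a KL function if this holds at every point of $\mathrm{dom}\,\partial h$ ($\partial$ = limiting subdifferential). Algorithm PGiPN: parameters $\epsilon\ge0$, $\mu_{\max}>\mu_{\min}>0$, $\tau>1$, $\alpha>0$, $b_1>0$, $b_2\ge1$, $\varrho\in(0,\frac12)$, $\sigma\in(0,\frac12)$, $\varsigma\in(\sigma,1]$, $\beta\in(0,1)$, $x^0\in\Omega$. Iteration $k$: (PG step) pick $\mu_k\in[\mu_{\min},\mu_{\max}]$; let $m_k$ be the smallest nonnegative integer $m$ such that some $\bar x^k\in\mathrm{prox}_{(\mu_k\tau^m)^{-1}g}(x^k-(\mu_k\tau^m)^{-1}\nabla f(x^k))$ satisfies $F(\bar x^k)\le F(x^k)-\frac\alpha2\|x^k-\bar x^k\|^2$; set $\bar\mu_k=\mu_k\tau^{m_k}$. If $\bar\mu_k\|x^k-\bar x^k\|\le\epsilon$, stop. If $\mathrm{supp}(x^k)=\mathrm{supp}(\bar x^k)$ and $\mathrm{supp}(Bx^k)=\mathrm{supp}(B\bar x^k)$ go to the Newton step, else set $x^{k+1}=\bar x^k$. (Newton step) let $\Pi_k=\Pi(x^k)$, $\Theta_k(x)=f(x^k)+\langle\nabla f(x^k),x-x^k\rangle+\frac12\langle x-x^k,G_k(x-x^k)\rangle+\delta_{\Pi_k}(x)$; find $y^k$ with $\Theta_k(y^k)\le\Theta_k(x^k)$ and $\mathrm{dist}(0,\partial\Theta_k(y^k))\le\frac{\min\{\bar\mu_k^{-1},1\}}2\min\{\|\bar\mu_k(x^k-\bar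 x^k)\|,\|\bar\mu_k(x^k-\bar x^k)\|^{1+\varsigma}\}$; set $d^k=y^k-x^k$; let $t_k$ be the smallest nonnegative integer $t$ with $f(x^k+\beta^td^k)\le f(x^k)+\varrho\beta^t\langle\nabla f(x^k),d^k\rangle$; $\alpha_k=\beta^{t_k}$, $x^{k+1}=x^k+\alpha_kd^k$. Choice of $G_k$ (with $e_k=b_1\|\bar\mu_k(x^k-\bar x^k)\|^\sigma$): either $G_k=\nabla^2f(x^k)+(b_2[-\lambda_{\min}(\nabla^2f(x^k))]_++e_k)I$; or, when $f(x)=h(Ax-b)$ with $h$ twice continuously differentiable and separable, $G_k=\nabla^2f(x^k)+b_2[-\lambda_{\min}(\nabla^2h(Ax^k-b))]_+A^\top A+e_kI$ or $G_k=A^\top[\nabla^2h(Ax^k-b)]_+A+e_kI$, where $t_+=\max\{t,0\}$ and $[D]_+$ replaces negative diagonal entries of the diagonal matrix $D$ by $0$. For such a run there is $k_0$ such that for all $k>k_0$ the Newton step is executed and the polyhedral sets $\Pi(x^k)$ all coincide; $\Pi_*$ denotes this common set. *)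

theory Defs
  imports "HOL-Analysis.Analysis"
begin

definition supp :: "real^'n \<Rightarrow> 'n set" where
  "supp x = {i. x $ i \<noteq> 0}"

definition l0 :: "real^'n \<Rightarrow> real" where
  "l0 x = real (card (supp x))"

definition box_set :: "real^'n \<Rightarrow> real^'n \<Rightarrow> (real^'n) set" where
  "box_set l u = {x. \<forall>i. l $ i \<le> x $ i \<and> x $ i \<le> u $ i}"

text \<open>Finite part of g (g = gfin + indicator of Omega).\<close>
definition gfin :: "real^'n^'p \<Rightarrow> real \<Rightarrow> real \<Rightarrow> real^'n \<Rightarrow> real" where
  "gfin B lam1 lam2 x = lam1 * l0 (B *v x) + lam2 * l0 x"

text \<open>prox_{c g}(z) = argmin_x (1/(2c)) |x - z|^2 + g(x); since g = +infinity
  outside Omega (which is nonempty), the minimisation is over Omega.\<close>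
definition prox_set :: "real^'n^'p \<Rightarrow> real \<Rightarrow> real \<Rightarrow> real^'n \<Rightarrow> real^'n \<Rightarrow> real \<Rightarrow> real^'n \<Rightarrow> (real^'n) set" where
  "prox_set B lam1 lam2 l u c z =
     {x \<in> box_set l u. \<forall>w \<in> box_set l u.
        (1 / (2 * c)) * (norm (x - z))\<^sup>2 + gfin B lam1 lam2 x
          \<le> (1 / (2 * c)) * (norm (w - z))\<^sup>2 + gfin B lam1 lam2 w}"

definition Pi_set :: "real^'n^'p \<Rightarrow> real^'n \<Rightarrow> real^'n \<Rightarrow> real^'n \<Rightarrow> (real^'n) set" where
  "Pi_set B l u z = {x \<in> box_set l u. supp x \<subseteq> supp z \<and> supp (B *v x) \<subseteq> supp (B *v z)}"

definition L_stationary :: "(real^'n \<Rightarrow> real^'n) \<Rightarrow> real^'n^'p \<Rightarrow> real \<Rightarrow> real \<Rightarrow> real^'n \<Rightarrow> real^'n \<Rightarrow> real^'n \<Rightarrow> bool" where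
  "L_stationary df B lam1 lam2 l u x \<longleftrightarrow>
     (\<exists>mu>0. x \<in> prox_set B lam1 lam2 l u (1 / mu) (x - (1 / mu) *\<^sub>R df x))"

definition normal_cone :: "('a::real_inner) set \<Rightarrow> 'a \<Rightarrow> 'a set" where
  "normal_cone C x = (if x \<in> C then {v. \<forall>z\<in>C. inner v (z - x) \<le> 0} else {})"

definition frechet_subdiff :: "('a::real_inner \<Rightarrow> ereal) \<Rightarrow> 'a \<Rightarrow> 'a set" where
  "frechet_subdiff h x =
     {v. \<bar>h x\<bar> \<noteq> \<infinity> \<and>
         (\<forall>e>0. \<exists>d>0. \<forall>z. norm (z - x) < d \<longrightarrow>
             ereal (real_of_ereal (h x) + inner v (z - x) - e * norm (z - x)) \<le> h z)}"

definition limiting_subdiff :: "('a::real_inner \<Rightarrow> ereal) \<Rightarrow> 'a \<Rightarrow> 'a set" where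
  "limiting_subdiff h x =
     {v. \<exists>xs vs. xs \<longlonglongrightarrow> x \<and> (\<lambda>k. h (xs k)) \<longlonglongrightarrow> h x \<and> vs \<longlonglongrightarrow> v \<and>
                 (\<forall>k. vs k \<in> frechet_subdiff h (xs k))}"

definition Upsilon :: "ereal \<Rightarrow> (real \<Rightarrow> real) \<Rightarrow> (real \<Rightarrow> real) \<Rightarrow> bool" where
  "Upsilon eta phi dphi \<longleftrightarrow>
     continuous_on {t. 0 \<le> t \<and> ereal t < eta} phi \<and>
     concave_on {t. 0 \<le> t \<and> ereal t < eta} phi \<and>
     (\<forall>t. 0 \<le> t \<and> ereal t < eta \<longrightarrow> phi t \<ge> 0) \<and>
     phi 0 = 0 \<and>
     (\<forall>t. 0 < t \<and> ereal t < eta \<longrightarrow> (phi has_real_derivative dphi t) (at t) \<and> dphi t > 0) \<and>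
     continuous_on {t. 0 < t \<and> ereal t < eta} dphi"

text \<open>KL property at xb (xb \<in> dom of the limiting subdifferential).  dist(0, \<emptyset>) = +\<infinity>,
  so points with empty subdifferential satisfy the inequality trivially.\<close>
definition KL_at :: "('a::real_inner \<Rightarrow> ereal) \<Rightarrow> 'a \<Rightarrow> bool" where
  "KL_at h xb \<longleftrightarrow>
     (\<exists>eta U phi dphi. eta > 0 \<and> open U \<and> xb \<in> U \<and> Upsilon eta phi dphi \<and>
        (\<forall>x\<in>U. h xb < h x \<and> h x < h xb + eta \<longrightarrow> limiting_subdiff h x \<noteq> {} \<longrightarrow>
            dphi (real_of_ereal (h x - h xb)) * infdist 0 (limiting_subdiff h x) \<ge> 1))"

definition KL_function :: "('a::real_inner \<Rightarrow> ereal) \<Rightarrow> bool" where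
  "KL_function h \<longleftrightarrow> (\<forall>xb. limiting_subdiff h xb \<noteq> {} \<longrightarrow> KL_at h xb)"

definition acc_points :: "(nat \<Rightarrow> 'a::topological_space) \<Rightarrow> 'a set" where
  "acc_points x = {z. \<exists>r. strict_mono r \<and> (x \<circ> r) \<longlonglongrightarrow> z}"

definition diag_mat :: "('n \<Rightarrow> real) \<Rightarrow> real^'n^'n" where
  "diag_mat d = (\<chi> i j. if i = j then d i else 0)"

definition diag_plus :: "real^'n^'n \<Rightarrow> real^'n^'n" where
  "diag_plus D = (\<chi> i j. if i = j then max (D $ i $ j) 0 else D $ i $ j)"

definition lambda_min :: "real^'n^'n \<Rightarrow> real" where
  "lambda_min M = Min {lam. \<exists>v. v \<noteq> 0 \<and> M *v v = lam *\<^sub>R v}"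

definition comp_structure ::
  "(real^'n \<Rightarrow> real) \<Rightarrow> real^'n^'m \<Rightarrow> real^'m \<Rightarrow> ('m \<Rightarrow> real \<Rightarrow> real) \<Rightarrow>
   ('m \<Rightarrow> real \<Rightarrow> real) \<Rightarrow> ('m \<Rightarrow> real \<Rightarrow> real) \<Rightarrow> bool" where
  "comp_structure f A b hh dh ddh \<longleftrightarrow>
     (\<forall>x. f x = (\<Sum>i\<in>UNIV. hh i ((A *v x - b) $ i))) \<and>
     (\<forall>i t. (hh i has_real_derivative dh i t) (at t)) \<and>
     (\<forall>i t. (dh i has_real_derivative ddh i t) (at t)) \<and>
     (\<forall>i. continuous_on UNIV (ddh i))"

definition hess_h :: "real^'n^'m \<Rightarrow> real^'m \<Rightarrow> ('m \<Rightarrow> real \<Rightarrow> real) \<Rightarrow> real^'n \<Rightarrow> real^'m^'m" where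
  "hess_h A b ddh x = diag_mat (\<lambda>i. ddh i ((A *v x - b) $ i))"

definition G_admissible ::
  "(real^'n \<Rightarrow> real) \<Rightarrow> (real^'n \<Rightarrow> real^'n^'n) \<Rightarrow> real^'n^'m \<Rightarrow> real^'m \<Rightarrow>
   ('m \<Rightarrow> real \<Rightarrow> real) \<Rightarrow> ('m \<Rightarrow> real \<Rightarrow> real) \<Rightarrow> ('m \<Rightarrow> real \<Rightarrow> real) \<Rightarrow>
   real \<Rightarrow> real \<Rightarrow> real^'n \<Rightarrow> real^'n^'n \<Rightarrow> bool" where
  "G_admissible f Hf A b hh dh ddh b2 e x G \<longleftrightarrow>
     G = Hf x + (b2 * max (- lambda_min (Hf x)) 0 + e) *\<^sub>R mat 1 \<or>
     (comp_structure f A b hh dh ddh \<and>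
       (G = Hf x + (b2 * max (- lambda_min (hess_h A b ddh x)) 0) *\<^sub>R (transpose A ** A) + e *\<^sub>R mat 1 \<or>
        G = transpose A ** diag_plus (hess_h A b ddh x) ** A + e *\<^sub>R mat 1))"

definition Fval :: "(real^'n \<Rightarrow> real) \<Rightarrow> real^'n^'p \<Rightarrow> real \<Rightarrow> real \<Rightarrow> real^'n \<Rightarrow> real" where
  "Fval f B lam1 lam2 x = f x + gfin B lam1 lam2 x"

text \<open>Sufficient decrease test of the PG step for the trial parameter c = mu * tau^m.\<close>
definition PG_accept where
  "PG_accept f df B lam1 lam2 l u alpha c xk z \<longleftrightarrow>
     z \<in> prox_set B lam1 lam2 l u (1 / c) (xk - (1 / c) *\<^sub>R df xk) \<and>
     Fval f B lam1 lam2 z \<le> Fval f B lam1 lam2 xk - alpha / 2 * (norm (xk - z))\<^sup>2"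

definition Theta :: "(real^'n \<Rightarrow> real) \<Rightarrow> (real^'n \<Rightarrow> real^'n) \<Rightarrow> (real^'n) set \<Rightarrow> real^'n^'n \<Rightarrow> real^'n \<Rightarrow> real^'n \<Rightarrow> ereal" where
  "Theta f df P G xk z =
     (if z \<in> P then ereal (f xk + inner (df xk) (z - xk) + 1/2 * inner (z - xk) (G *v (z - xk)))
      else \<infinity>)"

text \<open>A run of PGiPN: x iterates, mu trial stepsizes, m backtracking exponents, xbar PG points,
  G matrices, y inexact Newton solutions, t line-search exponents (G, y, t only matter at
  Newton steps).\<close>
definition PGiPN_run where
  "PGiPN_run f df Hf B lam1 lam2 l u A b hh dh ddh
     mumin mumax tau alpha b1 b2 rho sgm vsig beta
     (x :: nat \<Rightarrow> real^'n) (mu :: nat \<Rightarrow> real) (m :: nat \<Rightarrow> nat) xbar G y (t :: nat \<Rightarrow> nat) \<longleftrightarrow>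
   x 0 \<in> box_set l u \<and>
   (\<forall>k.
      let mbar = mu k * tau ^ m k;
          r = norm (mbar *\<^sub>R (x k - xbar k)) in
      mumin \<le> mu k \<and> mu k \<le> mumax \<and>
      PG_accept f df B lam1 lam2 l u alpha mbar (x k) (xbar k) \<and>
      (\<forall>m' < m k. \<not> (\<exists>z. PG_accept f df B lam1 lam2 l u alpha (mu k * tau ^ m') (x k) z)) \<and>
      (if supp (x k) = supp (xbar k) \<and> supp (B *v x k) = supp (B *v xbar k) then
         G_admissible f Hf A b hh dh ddh b2 (b1 * r powr sgm) (x k) (G k) \<and>
         Theta f df (Pi_set B l u (x k)) (G k) (x k) (y k)
           \<le> Theta f df (Pi_set B l u (x k)) (G k) (x k) (x k) \<and>
         limiting_subdiff (Theta f df (Pi_set B l u (x k)) (G k) (x k)) (y k) \<noteq> {} \<and>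
         infdist 0 (limiting_subdiff (Theta f df (Pi_set B l u (x k)) (G k) (x k)) (y k))
           \<le> min (1 / mbar) 1 / 2 * min r (r powr (1 + vsig)) \<and>
         f (x k + beta ^ t k *\<^sub>R (y k - x k))
           \<le> f (x k) + rho * beta ^ t k * inner (df (x k)) (y k - x k) \<and>
         (\<forall>t' < t k. \<not> (f (x k + beta ^ t' *\<^sub>R (y k - x k))
           \<le> f (x k) + rho * beta ^ t' * inner (df (x k)) (y k - x k))) \<and>
         x (Suc k) = x k + beta ^ t k *\<^sub>R (y k - x k)
       else x (Suc k) = xbar k))"

end

theory Submission
  imports Defs
begin

text \<open>Once the sets \<open>Pi_set B l u (x k)\<close> are all equal to a polytope \<open>P\<close>, the supports of the
  iterates are frozen, so every step is a Newton step and the proximal point is a projection onto \<open>P\<close>.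
  Monotonicity of the normal cone, applied to the inexact Newton point \<open>y k\<close> and the projection,
  bounds the residual by a multiple of \<open>norm (d k)\<close> with \<open>d k = y k - x k\<close>, and bounds
  \<open>(norm (d k))\<^sup>2\<close> by a multiple of the residual to the power \<open>1 - sgm\<close>; the Armijo decrease then
  drives both to zero.

  Near an accumulation point \<open>z\<close> the normals of \<open>P\<close> at \<open>y k\<close> provided by the inexactness
  criterion tend to \<open>- df z\<close>, which lies in the relative interior of the normal cone at \<open>z\<close> by A2.
  Hence \<open>y k - z\<close> is orthogonal to that whole cone, while \<open>P\<close> being polyhedral makes \<open>xi k\<close> an
  element of that cone orthogonal to \<open>x k - z\<close>.  So \<open>xi k\<close> is orthogonal to \<open>d k\<close>, and A3
  upgrades the Armijo decrease to a multiple of \<open>norm (df (x k) + xi k) * norm (x (Suc k) - x k)\<close>.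
  Combined with the KL inequality at \<open>z\<close>, the iterates stay near \<open>z\<close> and have finite length.\<close>

section \<open>Symmetric matrices and smallest eigenvalues\<close>

lemma inner_matrix_transpose:
  fixes M :: "real^'n^'m"
  shows "inner (M *v v) w = inner v (transpose M *v w)"
  by (metis dot_lmul_matrix inner_commute transpose_matrix_vector)

lemma symmetric_inner:
  fixes M :: "real^'n^'n"
  assumes "transpose M = M"
  shows "inner (M *v v) w = inner v (M *v w)"
  using inner_matrix_transpose[of M v w] assms by simp

text \<open>Eigenvectors for distinct eigenvalues are orthogonal, so choosing one per eigenvalue
  embeds the spectrum into a pairwise orthogonal set, which is finite. Finiteness gives the
  \<open>Min\<close> in \<open>lambda_min\<close> its meaning.\<close>

lemma finite_eigenvalues_symmetric:
  fixes M :: "real^'n^'n"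
  assumes sym: "transpose M = M"
  shows "finite {lam. \<exists>v. v \<noteq> 0 \<and> M *v v = lam *\<^sub>R v}" (is "finite ?E")
proof -
  have "\<forall>lam\<in>?E. \<exists>v. v \<noteq> 0 \<and> M *v v = lam *\<^sub>R v" by blast
  from bchoice[OF this]
  obtain v where v: "\<And>lam. lam \<in> ?E \<Longrightarrow> v lam \<noteq> 0 \<and> M *v v lam = lam *\<^sub>R v lam"
    by blast
  have orth: "inner (v a) (v b) = 0" if "a \<in> ?E" "b \<in> ?E" "a \<noteq> b" for a b
  proof -
    have "a * inner (v a) (v b) = b * inner (v a) (v b)"
      using symmetric_inner[OF sym, of "v a" "v b"] v[OF that(1)] v[OF that(2)] by simp
    then show ?thesis using that(3) by simp
  qed
  have inj: "inj_on v ?E"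
  proof (rule inj_onI)
    fix a b assume "a \<in> ?E" "b \<in> ?E" "v a = v b"
    then show "a = b" using orth[of a b] v[of b] by auto
  qed
  have "pairwise orthogonal (v ` ?E)"
    unfolding pairwise_def orthogonal_def using orth by blast
  then have "finite (v ` ?E)" by (rule pairwise_orthogonal_imp_finite)
  then show ?thesis using inj finite_imageD by blast
qed

text \<open>The quadratic form attains its minimum on the unit sphere. Subtracting that minimum
  leaves a positive semidefinite form vanishing at the minimiser \<open>v0\<close>, and such a form
  has \<open>v0\<close> in its kernel.\<close>

lemma ex_min_eigenvalue_symmetric:
  fixes M :: "real^'n^'n"
  assumes sym: "transpose M = M"
  obtains lam v where "v \<noteq> 0" "M *v v = lam *\<^sub>R v" "\<And>w. lam * (norm w)\<^sup>2 \<le> inner w (M *v w)"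
proof -
  have "continuous_on (sphere 0 1) (\<lambda>w::real^'n. inner w (M *v w))"
    by (intro continuous_on_inner continuous_on_id linear_continuous_on matrix_vector_mul_bounded_linear)
  moreover have "sphere 0 1 \<noteq> ({} :: (real^'n) set)" by simp
  ultimately obtain v0 where v0: "v0 \<in> sphere 0 1"
    and min: "\<And>w. w \<in> sphere 0 1 \<Longrightarrow> inner v0 (M *v v0) \<le> inner w (M *v w)"
    using continuous_attains_inf[OF compact_sphere, of 0 1 "\<lambda>w::real^'n. inner w (M *v w)"] by blast
  define lam where "lam = inner v0 (M *v v0)"
  have n0: "norm v0 = 1" using v0 by simp
  have lower: "lam * (norm w)\<^sup>2 \<le> inner w (M *v w)" for w
  proof (cases "w = 0")
    case False
    define w' where "w' = (1 / norm w) *\<^sub>R w"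
    have w: "w = norm w *\<^sub>R w'" using False by (simp add: w'_def)
    have "norm w' = 1" using False by (simp add: w'_def)
    then have "lam \<le> inner w' (M *v w')" using min by (simp add: lam_def)
    then have "lam * (norm w)\<^sup>2 \<le> inner w' (M *v w') * (norm w)\<^sup>2" by (simp add: mult_right_mono)
    also have "\<dots> = inner (norm w *\<^sub>R w') (M *v (norm w *\<^sub>R w'))"
      by (simp add: matrix_vector_mult_scaleR power2_eq_square)
    finally show ?thesis using w by simp
  qed simp
  define q where "q w = M *v w - lam *\<^sub>R w" for w
  have q_lin: "q (a + s *\<^sub>R c) = q a + s *\<^sub>R q c" for a c s
    by (simp add: q_def matrix_vector_right_distrib matrix_vector_mult_scaleR algebra_simps)
  have q_sym: "inner (q a) c = inner a (q c)" for a c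
    by (simp add: q_def inner_diff_left inner_diff_right symmetric_inner[OF sym])
  have q_pos: "0 \<le> inner w (q w)" for w
    using lower[of w] by (simp add: q_def inner_diff_right power2_norm_eq_inner)
  have q_v0: "inner v0 (q v0) = 0"
    using n0 by (simp add: q_def inner_diff_right lam_def flip: power2_norm_eq_inner)
  have "q v0 = 0"
  proof (rule ccontr)
    assume ne: "q v0 \<noteq> 0"
    define c where "c = inner (q v0) (q v0)"
    define d where "d = inner (q v0) (q (q v0))"
    have c: "c > 0" using ne by (simp add: c_def)
    have d: "d \<ge> 0" using q_pos by (simp add: d_def)
    \<comment> \<open>Along the line through \<open>v0\<close> in direction \<open>q v0\<close> the
      form equals \<open>2 * s * c + s\<^sup>2 * d\<close>; with \<open>c > 0\<close> this turns
      negative for small negative \<open>s\<close>.\<close>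
    have main: "0 \<le> 2 * s * c + s\<^sup>2 * d" for s
    proof -
      have "0 \<le> inner (v0 + s *\<^sub>R q v0) (q (v0 + s *\<^sub>R q v0))" by (rule q_pos)
      also have "\<dots> = 2 * s * c + s\<^sup>2 * d"
        using q_v0 q_sym[of v0 "q v0"]
        by (simp add: q_lin inner_add_left inner_add_right c_def d_def power2_eq_square algebra_simps)
      finally show ?thesis .
    qed
    \<comment> \<open>The \<open>+ 1\<close> keeps the quotient meaningful when
      \<open>d = 0\<close>; at \<open>s = - k\<close> the linear term outweighs the quadratic
      one.\<close>
    define k where "k = c / (d + 1)"
    have c_eq: "c = k * (d + 1)" and k: "k > 0" using c d by (auto simp: k_def)
    have "0 \<le> 2 * (- k) * c + (- k)\<^sup>2 * d" by (rule main)
    also have "\<dots> = k\<^sup>2 * (d - 2 * (d + 1))"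
      unfolding c_eq by (simp add: algebra_simps power2_eq_square)
    also have "\<dots> < 0" using k d by (intro mult_pos_neg) auto
    finally show False by simp
  qed
  then have "M *v v0 = lam *\<^sub>R v0" by (simp add: q_def)
  moreover have "v0 \<noteq> 0" using n0 by auto
  ultimately show thesis using that lower by blast
qed

text \<open>The minimum of the form on the sphere is an eigenvalue, so the finite spectrum is
  nonempty and \<open>Min\<close> picks a member of it. This member is at most the minimum of the
  form and so inherits the lower bound.\<close>

lemma lambda_min_symmetric:
  fixes M :: "real^'n^'n"
  assumes sym: "transpose M = M"
  shows "\<exists>v. v \<noteq> 0 \<and> M *v v = lambda_min M *\<^sub>R v"
    and "lambda_min M * (norm w)\<^sup>2 \<le> inner w (M *v w)"
proof -
  let ?E = "{lam. \<exists>v. v \<noteq> 0 \<and> M *v v = lam *\<^sub>R v}"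
  obtain lam v where lam: "v \<noteq> 0" "M *v v = lam *\<^sub>R v"
    "\<And>w. lam * (norm w)\<^sup>2 \<le> inner w (M *v w)"
    using ex_min_eigenvalue_symmetric[OF sym] by metis
  have "lam \<in> ?E" using lam by blast
  then show "\<exists>v. v \<noteq> 0 \<and> M *v v = lambda_min M *\<^sub>R v"
    using Min_in[OF finite_eigenvalues_symmetric[OF sym]] unfolding lambda_min_def by blast
  have "lambda_min M \<le> lam"
    using finite_eigenvalues_symmetric[OF sym] \<open>lam \<in> ?E\<close> unfolding lambda_min_def by (rule Min_le)
  then show "lambda_min M * (norm w)\<^sup>2 \<le> inner w (M *v w)"
    using lam(3)[of w] by (meson mult_right_mono order_trans zero_le_power2)
qed

lemma abs_lambda_min_le:
  fixes M :: "real^'n^'n"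
  assumes "transpose M = M" and bound: "\<And>w. norm (M *v w) \<le> C * norm w"
  shows "\<bar>lambda_min M\<bar> \<le> C"
proof -
  obtain v where v: "v \<noteq> 0" "M *v v = lambda_min M *\<^sub>R v"
    using lambda_min_symmetric(1)[OF assms(1)] by blast
  then have "\<bar>lambda_min M\<bar> * norm v \<le> C * norm v" using bound[of v] by simp
  then show ?thesis using v(1) by simp
qed

lemma norm_matrix_vector_mult_le:
  fixes M :: "real^'n^'m"
  shows "norm (M *v w) \<le> real CARD('m) * norm M * norm w"
proof -
  have "norm (M *v w) \<le> (\<Sum>i\<in>UNIV. \<bar>(M *v w) $ i\<bar>)" by (rule norm_le_l1_cart)
  also have "\<dots> \<le> (\<Sum>i\<in>(UNIV::'m set). norm M * norm w)"
  proof (rule sum_mono)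
    fix i
    have "\<bar>(M *v w) $ i\<bar> \<le> norm (M $ i) * norm w"
      using Cauchy_Schwarz_ineq2[of "M $ i" w] by (simp add: matrix_vector_mul_component)
    also have "\<dots> \<le> norm M * norm w" by (intro mult_right_mono Finite_Cartesian_Product.norm_nth_le) simp
    finally show "\<bar>(M *v w) $ i\<bar> \<le> norm M * norm w" .
  qed
  finally show ?thesis by simp
qed

lemma transpose_diag_mat: "transpose (diag_mat d) = diag_mat d"
  by (auto simp: diag_mat_def transpose_def vec_eq_iff)

lemma inner_diag_mat_mult: "inner w (diag_mat d *v v) = (\<Sum>i\<in>UNIV. d i * w $ i * v $ i)"
proof -
  have "(diag_mat d *v v) $ i = d i * v $ i" for i
    by (simp add: diag_mat_def matrix_vector_mult_def if_distrib[of "\<lambda>a. a * _"] cong: if_cong)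
  then show ?thesis by (simp add: inner_vec_def algebra_simps)
qed

lemma diag_plus_diag_mat: "diag_plus (diag_mat d) = diag_mat (\<lambda>i. max (d i) 0)"
  by (auto simp: diag_plus_def diag_mat_def vec_eq_iff)

section \<open>The Hessian and the regularised Newton matrices\<close>

text \<open>The mean value theorem is applied twice, to the increment of \<open>f\<close> in
  direction \<open>h\<close> and then to the gradient along \<open>k\<close>. The mixed difference
  is symmetric in \<open>h\<close> and \<open>k\<close>, which is what later forces the Hessian to
  be symmetric.\<close>

lemma hessian_mixed_difference:
  fixes f :: "real^'n \<Rightarrow> real"
  assumes f_grad: "\<And>z. (f has_derivative (\<lambda>h. inner (df z) h)) (at z)"
    and f_hess: "\<And>z. (df has_derivative (\<lambda>h. Hf z *v h)) (at z)"
    and s: "s > 0"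
  shows "\<exists>a b. 0 \<le> a \<and> a \<le> s \<and> 0 \<le> b \<and> b \<le> s \<and>
      f (x + s *\<^sub>R h + s *\<^sub>R k) - f (x + s *\<^sub>R h) - f (x + s *\<^sub>R k) + f x
        = s\<^sup>2 * inner (Hf (x + a *\<^sub>R h + b *\<^sub>R k) *v k) h"
proof -
  define p where "p a = f (x + a *\<^sub>R h + s *\<^sub>R k) - f (x + a *\<^sub>R h)" for a
  have der_line: "((\<lambda>a. f (w + a *\<^sub>R h)) has_real_derivative inner (df (w + a *\<^sub>R h)) h) (at a)" for a w
  proof -
    have "((\<lambda>a. w + a *\<^sub>R h) has_derivative (\<lambda>t. t *\<^sub>R h)) (at a)"
      by (auto intro!: derivative_eq_intros)
    from has_derivative_compose[OF this f_grad] show ?thesis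
      by (simp add: has_field_derivative_def mult_commute_abs)
  qed
  have p: "(p has_real_derivative
      inner (df (x + a *\<^sub>R h + s *\<^sub>R k)) h - inner (df (x + a *\<^sub>R h)) h) (at a)" for a
    using DERIV_diff[OF der_line[of "x + s *\<^sub>R k" a] der_line[of x a]]
    by (simp add: p_def[abs_def] add_ac)
  obtain a where a: "0 < a" "a < s"
    "p s - p 0 = s * (inner (df (x + a *\<^sub>R h + s *\<^sub>R k)) h - inner (df (x + a *\<^sub>R h)) h)"
    using MVT2[OF s p] by auto
  define q where "q b = inner (df (x + a *\<^sub>R h + b *\<^sub>R k)) h" for b
  have q: "(q has_real_derivative inner (Hf (x + a *\<^sub>R h + b *\<^sub>R k) *v k) h) (at b)" for b
  proof -
    have "((\<lambda>b. x + a *\<^sub>R h + b *\<^sub>R k) has_derivative (\<lambda>t. t *\<^sub>R k)) (at b)"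
      by (auto intro!: derivative_eq_intros)
    from has_derivative_inner_left[OF has_derivative_compose[OF this f_hess], of h] show ?thesis
      by (simp add: has_field_derivative_def q_def[abs_def] matrix_vector_mult_scaleR mult_commute_abs)
  qed
  obtain b where b: "0 < b" "b < s" "q s - q 0 = s * inner (Hf (x + a *\<^sub>R h + b *\<^sub>R k) *v k) h"
    using MVT2[OF s q] by auto
  have "p s - p 0 = s\<^sup>2 * inner (Hf (x + a *\<^sub>R h + b *\<^sub>R k) *v k) h"
    using a(3) b(3) by (simp add: q_def power2_eq_square)
  then show ?thesis using a b
    by (intro exI[of _ a] exI[of _ b]) (auto simp: p_def)
qed

text \<open>Schwarz's theorem: the mixed difference divided by \<open>s\<^sup>2\<close> is unchanged
  when \<open>h\<close> and \<open>k\<close> are swapped, while continuity of \<open>Hf\<close>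
  makes it converge to the bilinear form of the Hessian.\<close>

lemma hessian_symmetric:
  fixes f :: "real^'n \<Rightarrow> real"
  assumes f_grad: "\<And>z. (f has_derivative (\<lambda>h. inner (df z) h)) (at z)"
    and f_hess: "\<And>z. (df has_derivative (\<lambda>h. Hf z *v h)) (at z)"
    and cont: "continuous_on UNIV Hf"
  shows "transpose (Hf x) = Hf x"
proof -
  have lim: "(\<lambda>n. (f (x + s n *\<^sub>R h + s n *\<^sub>R k) - f (x + s n *\<^sub>R h) - f (x + s n *\<^sub>R k) + f x) / (s n)\<^sup>2)
      \<longlonglongrightarrow> inner (Hf x *v k) h" if s_def: "s = (\<lambda>n. inverse (real (Suc n)))" for h k s
  proof -
    have s: "s n > 0" for n by (simp add: s_def)
    have s0: "s \<longlonglongrightarrow> 0" unfolding s_def by (rule LIMSEQ_inverse_real_of_nat)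
    have "\<forall>n. \<exists>a b. 0 \<le> a \<and> a \<le> s n \<and> 0 \<le> b \<and> b \<le> s n \<and>
      f (x + s n *\<^sub>R h + s n *\<^sub>R k) - f (x + s n *\<^sub>R h) - f (x + s n *\<^sub>R k) + f x
        = (s n)\<^sup>2 * inner (Hf (x + a *\<^sub>R h + b *\<^sub>R k) *v k) h"
      using hessian_mixed_difference[OF f_grad f_hess s] by blast
    then obtain a b where ab: "\<And>n. 0 \<le> a n" "\<And>n. a n \<le> s n" "\<And>n. 0 \<le> b n" "\<And>n. b n \<le> s n"
      "\<And>n. f (x + s n *\<^sub>R h + s n *\<^sub>R k) - f (x + s n *\<^sub>R h) - f (x + s n *\<^sub>R k) + f x
        = (s n)\<^sup>2 * inner (Hf (x + a n *\<^sub>R h + b n *\<^sub>R k) *v k) h"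
      by metis
    have a0: "a \<longlonglongrightarrow> 0" by (rule tendsto_sandwich[OF _ _ tendsto_const s0]) (use ab(1,2) in auto)
    have b0: "b \<longlonglongrightarrow> 0" by (rule tendsto_sandwich[OF _ _ tendsto_const s0]) (use ab(3,4) in auto)
    have "(\<lambda>n. x + a n *\<^sub>R h + b n *\<^sub>R k) \<longlonglongrightarrow> x + 0 *\<^sub>R h + 0 *\<^sub>R k"
      by (intro tendsto_intros a0 b0)
    then have "(\<lambda>n. Hf (x + a n *\<^sub>R h + b n *\<^sub>R k)) \<longlonglongrightarrow> Hf x"
      using continuous_on_tendsto_compose[OF cont, of _ x] by simp
    moreover have "inner (M *v k) h = (\<Sum>i\<in>UNIV. (\<Sum>j\<in>UNIV. M $ i $ j * k $ j) * h $ i)" for M :: "real^'n^'n"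
      by (simp add: inner_vec_def matrix_vector_mult_def)
    ultimately have "(\<lambda>n. inner (Hf (x + a n *\<^sub>R h + b n *\<^sub>R k) *v k) h) \<longlonglongrightarrow> inner (Hf x *v k) h"
      by (simp only:) (intro tendsto_intros, auto)
    moreover have "(f (x + s n *\<^sub>R h + s n *\<^sub>R k) - f (x + s n *\<^sub>R h) - f (x + s n *\<^sub>R k) + f x) / (s n)\<^sup>2
      = inner (Hf (x + a n *\<^sub>R h + b n *\<^sub>R k) *v k) h" for n
      using ab(5)[of n] s[of n] by simp
    ultimately show ?thesis by simp
  qed
  have sym: "inner (Hf x *v k) h = inner (Hf x *v h) k" for h k
    by (rule LIMSEQ_unique[OF lim[OF refl, of h k]])
       (use lim[OF refl, of k h] in \<open>simp add: add_ac diff_diff_eq\<close>)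
  have "Hf x $ i $ j = Hf x $ j $ i" for i j
    using sym[of "axis j 1" "axis i 1"]
    by (simp add: matrix_vector_mult_basis inner_axis column_def)
  then show ?thesis by (simp add: transpose_def vec_eq_iff)
qed

text \<open>\<open>df\<close> and \<open>Hf\<close> are known only as derivatives of
  \<open>f\<close>, so uniqueness of derivatives identifies first the gradient and then the Hessian
  with the expressions given by the chain rule.\<close>

lemma comp_structure_hessian:
  fixes f :: "real^'n \<Rightarrow> real" and A :: "real^'n^'m" and v w x :: "real^'n"
  assumes f_grad: "\<And>z. (f has_derivative (\<lambda>h. inner (df z) h)) (at z)"
    and f_hess: "\<And>z. (df has_derivative (\<lambda>h. Hf z *v h)) (at z)"
    and cs: "comp_structure f A b hh dh ddh"
  shows "inner v (Hf x *v w) = inner (A *v v) (hess_h A b ddh x *v (A *v w))"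
proof -
  have f_eq: "f = (\<lambda>z. \<Sum>i\<in>UNIV. hh i ((A *v z - b) $ i))"
    and hh: "\<And>i t. (hh i has_real_derivative dh i t) (at t)"
    and dh: "\<And>i t. (dh i has_real_derivative ddh i t) (at t)"
    using cs unfolding comp_structure_def by auto
  have lin: "((\<lambda>z. (A *v z - b) $ i) has_derivative (\<lambda>h. (A *v h) $ i)) (at z)" for i z
  proof -
    have "((\<lambda>z. A *v z - b) has_derivative (\<lambda>h. A *v h)) (at z)"
      by (rule has_derivative_eq_rhs, rule has_derivative_diff[OF
          bounded_linear_imp_has_derivative[OF matrix_vector_mul_bounded_linear] has_derivative_const]) simp
    from bounded_linear.has_derivative[OF bounded_linear_vec_nth[of i] this] show ?thesis .
  qed
  have grad: "inner (df z) h = (\<Sum>i\<in>UNIV. dh i ((A *v z - b) $ i) * (A *v h) $ i)" for z h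
  proof -
    have "(f has_derivative (\<lambda>h. \<Sum>i\<in>UNIV. dh i ((A *v z - b) $ i) * (A *v h) $ i)) (at z)"
      unfolding f_eq
      by (intro has_derivative_sum has_derivative_compose[OF lin, unfolded o_def]
          hh[unfolded has_field_derivative_def])
    from has_derivative_unique[OF f_grad this] show ?thesis by metis
  qed
  have "((\<lambda>z. inner (df z) v) has_derivative (\<lambda>h. inner (Hf x *v h) v)) (at x)"
    by (intro has_derivative_inner_left f_hess)
  moreover have "((\<lambda>z. inner (df z) v) has_derivative
      (\<lambda>h. \<Sum>i\<in>UNIV. ddh i ((A *v x - b) $ i) * (A *v h) $ i * (A *v v) $ i)) (at x)"
    unfolding grad
    by (intro has_derivative_sum has_derivative_mult_left has_derivative_compose[OF lin, unfolded o_def]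
          dh[unfolded has_field_derivative_def])
  ultimately have "inner (Hf x *v w) v = (\<Sum>i\<in>UNIV. ddh i ((A *v x - b) $ i) * (A *v w) $ i * (A *v v) $ i)"
    by (rule has_derivative_unique[THEN fun_cong])
  moreover have "inner (A *v v) (hess_h A b ddh x *v (A *v w))
      = (\<Sum>i\<in>UNIV. ddh i ((A *v x - b) $ i) * (A *v w) $ i * (A *v v) $ i)"
    unfolding hess_h_def inner_diag_mat_mult by (intro sum.cong) (simp_all only: mult_ac)
  ultimately show ?thesis by (simp only: inner_commute)
qed

text \<open>As \<open>b2 \<ge> 1\<close>, the shift by \<open>b2 * max (- lambda_min M) 0\<close>
  cancels all negative curvature, where \<open>M\<close> is the Hessian itself or, after passing to
  \<open>A *v v\<close>, the inner diagonal Hessian. Clipping negative diagonal entries has the same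
  effect, and the term \<open>e\<close> survives.\<close>

lemma G_admissible_lower:
  fixes f :: "real^'n \<Rightarrow> real" and A :: "real^'n^'m" and v :: "real^'n"
  assumes f_grad: "\<And>z. (f has_derivative (\<lambda>h. inner (df z) h)) (at z)"
    and f_hess: "\<And>z. (df has_derivative (\<lambda>h. Hf z *v h)) (at z)"
    and cont: "continuous_on UNIV Hf" and b2: "b2 \<ge> 1"
    and G: "G_admissible f Hf A b hh dh ddh b2 e x G"
  shows "e * (norm v)\<^sup>2 \<le> inner v (G *v v)"
proof -
  have pos: "0 \<le> inner w (M *v w) + b2 * max (- lambda_min M) 0 * (norm w)\<^sup>2"
    if "transpose M = M" for M :: "real^'k^'k" and w
  proof -
    have "- lambda_min M \<le> b2 * max (- lambda_min M) 0"
      using mult_right_mono[OF b2, of "max (- lambda_min M) 0"] by simp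
    then have "- lambda_min M * (norm w)\<^sup>2 \<le> b2 * max (- lambda_min M) 0 * (norm w)\<^sup>2"
      by (intro mult_right_mono) auto
    then show ?thesis using lambda_min_symmetric(2)[OF that, of w] by simp
  qed
  have mat1: "(c *\<^sub>R M) *v w = c *\<^sub>R (M *v w)" for c and M :: "real^'k^'j" and w
    by (simp add: scaleR_matrix_vector_assoc)
  note defs = matrix_vector_mult_add_rdistrib mat1 inner_add_right power2_norm_eq_inner[symmetric]
  from G consider
    (1) "G = Hf x + (b2 * max (- lambda_min (Hf x)) 0 + e) *\<^sub>R mat 1"
  | (2) "comp_structure f A b hh dh ddh"
      "G = Hf x + (b2 * max (- lambda_min (hess_h A b ddh x)) 0) *\<^sub>R (transpose A ** A) + e *\<^sub>R mat 1"
  | (3) "G = transpose A ** diag_plus (hess_h A b ddh x) ** A + e *\<^sub>R mat 1"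
    unfolding G_admissible_def by blast
  then show ?thesis
  proof cases
    case 1
    then show ?thesis using pos[OF hessian_symmetric[OF f_grad f_hess cont, of x], of v]
      by (simp add: defs algebra_simps)
  next
    case 2
    have "inner v ((transpose A ** A) *v v) = (norm (A *v v))\<^sup>2"
      by (simp add: power2_norm_eq_inner inner_matrix_transpose[of A] flip: matrix_vector_mul_assoc)
    then show ?thesis
      using pos[of "hess_h A b ddh x" "A *v v"] comp_structure_hessian[OF f_grad f_hess 2(1), of v x v]
      by (simp add: 2(2) defs hess_h_def transpose_diag_mat)
  next
    case 3
    have "inner v ((transpose A ** diag_plus (hess_h A b ddh x) ** A) *v v)
        = inner (A *v v) (diag_plus (hess_h A b ddh x) *v (A *v v))"
      by (simp add: inner_matrix_transpose[of A] flip: matrix_vector_mul_assoc)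
    also have "\<dots> \<ge> 0"
      by (simp add: hess_h_def diag_plus_diag_mat inner_diag_mat_mult)
         (intro sum_nonneg, simp add: mult.assoc)
    finally show ?thesis by (simp add: 3 defs)
  qed
qed

lemma compact_matrix_bound:
  fixes M :: "'a::metric_space \<Rightarrow> real^'n^'m"
  assumes "compact S" "continuous_on S M"
  obtains C where "C \<ge> 0" "\<And>x w. x \<in> S \<Longrightarrow> norm (M x *v w) \<le> C * norm w"
proof -
  have "bounded (M ` S)" using assms by (intro compact_imp_bounded compact_continuous_image)
  then obtain K where K: "K > 0" "\<And>x. x \<in> S \<Longrightarrow> norm (M x) \<le> K"
    unfolding bounded_pos by blast
  show thesis
  proof (rule that)
    show "0 \<le> real CARD('m) * K" using K by simp
    fix x w assume "x \<in> S"
    have "norm (M x *v w) \<le> real CARD('m) * norm (M x) * norm w" by (rule norm_matrix_vector_mult_le)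
    also have "\<dots> \<le> real CARD('m) * K * norm w" using K(2)[OF \<open>x \<in> S\<close>]
      by (intro mult_right_mono mult_left_mono) auto
    finally show "norm (M x *v w) \<le> real CARD('m) * K * norm w" .
  qed
qed

text \<open>The matrices depending continuously on \<open>x\<close> are bounded on the compact set,
  and the terms with \<open>lambda_min\<close> are bounded through the operator bound of the matrix
  whose eigenvalue is taken. One constant serves all points of \<open>S\<close> and all
  regularisations up to \<open>E\<close>.\<close>

lemma G_admissible_bound:
  fixes f :: "real^'n \<Rightarrow> real" and A :: "real^'n^'m"
  assumes f_grad: "\<And>z. (f has_derivative (\<lambda>h. inner (df z) h)) (at z)"
    and f_hess: "\<And>z. (df has_derivative (\<lambda>h. Hf z *v h)) (at z)"
    and cont: "continuous_on UNIV Hf" and b2: "b2 \<ge> 1" and S: "compact S"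
  obtains C where "C \<ge> 0"
    "\<And>x e G (v :: real^'n). x \<in> S \<Longrightarrow> 0 \<le> e \<Longrightarrow> e \<le> E \<Longrightarrow> G_admissible f Hf A b hh dh ddh b2 e x G \<Longrightarrow>
      norm (G *v v) \<le> C * norm v"
proof -
  have mat1: "(c *\<^sub>R M) *v w = c *\<^sub>R (M *v w)" for c and M :: "real^'k^'j" and w
    by (simp add: scaleR_matrix_vector_assoc)
  have lam: "b2 * max (- lambda_min M) 0 \<le> b2 * C"
    if "transpose M = M" "\<And>w. norm (M *v w) \<le> C * norm w" "C \<ge> 0" for M :: "real^'k^'k" and C
    using abs_lambda_min_le[OF that(1,2)] that(3) b2 by (intro mult_left_mono) auto
  obtain C1 where C1: "C1 \<ge> 0" "\<And>x w. x \<in> S \<Longrightarrow> norm (Hf x *v w) \<le> C1 * norm w"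
    using compact_matrix_bound[OF S continuous_on_subset[OF cont]] by (metis subset_UNIV)
  define N where "N = real CARD('n) * norm (transpose A ** A)"
  have N: "N \<ge> 0" "\<And>w. norm ((transpose A ** A) *v w) \<le> N * norm w"
    by (simp_all add: N_def norm_matrix_vector_mult_le)
  \<comment> \<open>Outside the composite case the bound holds vacuously, so the constant 0 is
    taken; \<open>C3\<close> is treated alike.\<close>
  obtain C2 where C2: "C2 \<ge> 0" "comp_structure f A b hh dh ddh \<Longrightarrow>
      \<forall>x\<in>S. \<forall>w. norm (hess_h A b ddh x *v w) \<le> C2 * norm w"
  proof (cases "comp_structure f A b hh dh ddh")
    case True
    then have ddh: "\<And>i. continuous_on UNIV (ddh i)" by (simp add: comp_structure_def)
    have "continuous_on S (hess_h A b ddh)"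
      unfolding hess_h_def diag_mat_def
    proof (intro continuous_on_vec_lambda)
      fix i j :: 'm
      have "continuous_on S (\<lambda>x. A *v x)"
        by (intro linear_continuous_on matrix_vector_mul_bounded_linear)
      then have "continuous_on S (\<lambda>x. (A *v x - b) $ i)" by (intro continuous_intros)
      from continuous_on_compose2[OF ddh this]
      show "continuous_on S (\<lambda>x. if i = j then ddh i ((A *v x - b) $ i) else 0)"
        by (cases "i = j") auto
    qed
    from compact_matrix_bound[OF S this] that show ?thesis by metis
  qed (use that[of 0] in auto)
  obtain C3 where C3: "C3 \<ge> 0" "comp_structure f A b hh dh ddh \<Longrightarrow>
      \<forall>x\<in>S. \<forall>w. norm ((transpose A ** diag_plus (hess_h A b ddh x) ** A) *v w) \<le> C3 * norm w"
  proof (cases "comp_structure f A b hh dh ddh")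
    case True
    then have ddh: "\<And>i. continuous_on UNIV (ddh i)" by (simp add: comp_structure_def)
    have 1: "continuous_on S (\<lambda>x. diag_plus (hess_h A b ddh x))"
      unfolding hess_h_def diag_plus_diag_mat
      unfolding diag_mat_def
    proof (intro continuous_on_vec_lambda)
      fix i j :: 'm
      have "continuous_on S (\<lambda>x. A *v x)"
        by (intro linear_continuous_on matrix_vector_mul_bounded_linear)
      then have "continuous_on S (\<lambda>x. (A *v x - b) $ i)" by (intro continuous_intros)
      from continuous_on_compose2[OF ddh this]
      show "continuous_on S (\<lambda>x. if i = j then max (ddh i ((A *v x - b) $ i)) 0 else 0)"
        by (cases "i = j") (auto intro!: continuous_intros)
    qed
    have "continuous_on S (\<lambda>x. transpose A ** diag_plus (hess_h A b ddh x) ** A)"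
      unfolding matrix_matrix_mult_def
      by (intro continuous_on_vec_lambda)
         (simp, intro continuous_intros continuous_on_component 1)
    from compact_matrix_bound[OF S this] that show ?thesis by metis
  qed (use that[of 0] in auto)
  define C where "C = C1 + b2 * C1 + b2 * C2 * N + C3 + \<bar>E\<bar>"
  show thesis
  proof (rule that)
    show "C \<ge> 0" using C1 C2 C3 N b2 by (simp add: C_def)
    fix x e G and v :: "real^'n" assume x: "x \<in> S" and e: "0 \<le> e" "e \<le> E"
      and G: "G_admissible f Hf A b hh dh ddh b2 e x G"
    have ev: "norm (e *\<^sub>R v) \<le> \<bar>E\<bar> * norm v" using e by (simp add: mult_right_mono)
    have Hv: "norm (Hf x *v v) \<le> C1 * norm v" by (rule C1(2)[OF x])
    have nonneg: "0 \<le> C1 * norm v" "0 \<le> b2 * C1 * norm v" "0 \<le> b2 * C2 * N * norm v" "0 \<le> C3 * norm v"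
      using C1 C2 C3 N b2 by auto
    have Cv: "C * norm v = C1 * norm v + b2 * C1 * norm v + b2 * C2 * N * norm v + C3 * norm v + \<bar>E\<bar> * norm v"
      by (simp add: C_def algebra_simps)
    from G consider
      (1) "G = Hf x + (b2 * max (- lambda_min (Hf x)) 0 + e) *\<^sub>R mat 1"
    | (2) "comp_structure f A b hh dh ddh"
        "G = Hf x + (b2 * max (- lambda_min (hess_h A b ddh x)) 0) *\<^sub>R (transpose A ** A) + e *\<^sub>R mat 1"
    | (3) "comp_structure f A b hh dh ddh" "G = transpose A ** diag_plus (hess_h A b ddh x) ** A + e *\<^sub>R mat 1"
      unfolding G_admissible_def by blast
    then show "norm (G *v v) \<le> C * norm v"
    proof cases
      case 1
      let ?c = "b2 * max (- lambda_min (Hf x)) 0"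
      have Gv: "G *v v = Hf x *v v + ?c *\<^sub>R v + e *\<^sub>R v"
        unfolding 1 matrix_vector_mult_add_rdistrib mat1 by (simp add: algebra_simps)
      moreover have "norm (?c *\<^sub>R v) \<le> b2 * C1 * norm v"
        using lam[OF hessian_symmetric[OF f_grad f_hess cont] C1(2)[OF x] C1(1)] b2
        by (simp add: mult_right_mono)
      ultimately show ?thesis unfolding Gv using Hv ev nonneg Cv
        norm_triangle_ineq[of "Hf x *v v + ?c *\<^sub>R v" "e *\<^sub>R v"] norm_triangle_ineq[of "Hf x *v v" "?c *\<^sub>R v"]
        by linarith
    next
      case 2
      let ?c = "b2 * max (- lambda_min (hess_h A b ddh x)) 0"
      let ?w = "(transpose A ** A) *v v"
      have Gv: "G *v v = Hf x *v v + ?c *\<^sub>R ?w + e *\<^sub>R v"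
        unfolding 2(2) matrix_vector_mult_add_rdistrib mat1 by simp
      moreover have "norm (?c *\<^sub>R ?w) \<le> b2 * C2 * (N * norm v)"
      proof -
        have "?c \<le> b2 * C2"
          using C2(2)[OF 2(1)] x C2(1)
          by (intro lam) (auto simp: hess_h_def transpose_diag_mat)
        moreover have "0 \<le> ?c" using b2 by simp
        ultimately show ?thesis using N(2)[of v] by (simp add: mult_mono)
      qed
      ultimately show ?thesis unfolding Gv using Hv ev nonneg Cv
        norm_triangle_ineq[of "Hf x *v v + ?c *\<^sub>R ?w" "e *\<^sub>R v"] norm_triangle_ineq[of "Hf x *v v" "?c *\<^sub>R ?w"]
        unfolding mult.assoc by linarith
    next
      case 3
      let ?w = "(transpose A ** diag_plus (hess_h A b ddh x) ** A) *v v"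
      have Gv: "G *v v = ?w + e *\<^sub>R v"
        unfolding 3(2) matrix_vector_mult_add_rdistrib mat1 by simp
      moreover have "norm ?w \<le> C3 * norm v" using C3(2)[OF 3(1)] x by blast
      ultimately show ?thesis unfolding Gv using ev nonneg Cv norm_triangle_ineq[of ?w "e *\<^sub>R v"] by linarith
    qed
  qed
qed

section \<open>Normal cones, subdifferentials and face identification\<close>

lemma normal_coneI: "x \<in> C \<Longrightarrow> (\<And>z. z \<in> C \<Longrightarrow> inner v (z - x) \<le> 0) \<Longrightarrow> v \<in> normal_cone C x"
  by (simp add: normal_cone_def)

lemma normal_coneD:
  assumes "v \<in> normal_cone C x"
  shows "x \<in> C" and "\<And>z. z \<in> C \<Longrightarrow> inner v (z - x) \<le> 0"
  using assms by (auto simp: normal_cone_def split: if_splits)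

lemma normal_cone_monotone:
  assumes "v \<in> normal_cone C x" "w \<in> normal_cone C z"
  shows "0 \<le> inner (v - w) (x - z)"
  using normal_coneD(2)[OF assms(1) normal_coneD(1)[OF assms(2)]]
    normal_coneD(2)[OF assms(2) normal_coneD(1)[OF assms(1)]]
  by (simp add: inner_diff_left inner_diff_right)

text \<open>The sum rule for a smooth function plus an indicator. Convexity makes the local
  condition global: tested along the segment from \<open>x\<close> to \<open>z\<close> and divided
  by the parameter, the first-order inequality becomes the normal cone inequality at
  \<open>z\<close>.\<close>

lemma frechet_subdiff_restrict:
  fixes q :: "'a::euclidean_space \<Rightarrow> real"
  assumes P: "convex P" and q: "(q has_derivative (\<lambda>h. inner g h)) (at x)"
  shows "v \<in> frechet_subdiff (\<lambda>z. if z \<in> P then ereal (q z) else \<infinity>) x \<longleftrightarrow> v - g \<in> normal_cone P x"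
    (is "?L \<longleftrightarrow> ?R")
proof
  assume ?L
  then have x: "x \<in> P" and sub: "\<forall>e>0. \<exists>d>0. \<forall>z. norm (z - x) < d \<longrightarrow>
      z \<in> P \<longrightarrow> q x + inner v (z - x) - e * norm (z - x) \<le> q z"
    unfolding frechet_subdiff_def by (auto split: if_splits)
  show ?R
  proof (rule normal_coneI[OF x])
    fix z assume z: "z \<in> P"
    show "inner (v - g) (z - x) \<le> 0"
    proof (rule field_le_epsilon)
      fix e :: real assume e: "e > 0"
      \<comment> \<open>The subgradient inequality and the derivative each cost \<open>e'\<close>
        times the distance, which explains the factor 2; the \<open>+ 1\<close> covers
        \<open>z = x\<close>.\<close>
      define e' where "e' = e / (norm (z - x) + 1) / 2"
      have nz: "0 < norm (z - x) + 1" using norm_ge_zero[of "z - x"] by linarith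
      have e': "e' > 0" using e nz by (simp add: e'_def)
      obtain d1 where d1: "d1 > 0" "\<And>w. norm (w - x) < d1 \<Longrightarrow> w \<in> P \<Longrightarrow>
          q x + inner v (w - x) - e' * norm (w - x) \<le> q w"
        using sub e' by blast
      obtain d2 where d2: "d2 > 0" "\<And>w. norm (w - x) < d2 \<Longrightarrow>
          norm (q w - q x - inner g (w - x)) \<le> e' * norm (w - x)"
        using q e' unfolding has_derivative_at_alt by blast
      \<comment> \<open>The bound 1 keeps the test point on the segment, hence in \<open>P\<close>;
        the other bound brings it within both radii.\<close>
      define t where "t = min 1 (min d1 d2 / (2 * (norm (z - x) + 1)))"
      have t: "0 < t" "t \<le> 1" using d1 d2 nz by (auto simp: t_def)
      have "t * norm (z - x) < min d1 d2"
      proof -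
        have "t * norm (z - x) \<le> min d1 d2 / (2 * (norm (z - x) + 1)) * norm (z - x)"
          by (intro mult_right_mono) (auto simp: t_def)
        also have "\<dots> = min d1 d2 * (norm (z - x) / (2 * (norm (z - x) + 1)))" by simp
        also have "\<dots> < min d1 d2 * 1"
          by (intro mult_strict_left_mono) (use d1 d2 nz in \<open>auto simp: divide_simps\<close>)
        finally show ?thesis by simp
      qed
      define w where "w = x + t *\<^sub>R (z - x)"
      have w: "w \<in> P"
        using convexD_alt[OF P x z, of t] t by (simp add: w_def algebra_simps)
      have wx: "w - x = t *\<^sub>R (z - x)" by (simp add: w_def)
      have nw: "norm (w - x) < d1" "norm (w - x) < d2"
        using \<open>t * norm (z - x) < min d1 d2\<close> t by (auto simp: wx)
      have "inner v (w - x) - inner g (w - x) \<le> 2 * e' * norm (w - x)"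
        using d1(2)[OF nw(1) w] d2(2)[OF nw(2)] unfolding real_norm_def by linarith
      moreover have "norm (w - x) = t * norm (z - x)" using t by (simp add: wx)
      moreover have "inner v (w - x) - inner g (w - x) = t * inner (v - g) (z - x)"
        by (simp add: wx inner_diff_left right_diff_distrib)
      ultimately have "t * inner (v - g) (z - x) \<le> t * (2 * e' * norm (z - x))"
        by (simp add: mult_ac)
      then have "inner (v - g) (z - x) \<le> 2 * e' * norm (z - x)" using t by simp
      also have "\<dots> = e * (norm (z - x) / (norm (z - x) + 1))" 
      proof -
        have "2 * (c / 2) = c" for c :: real by simp
        then have "2 * e' = e / (norm (z - x) + 1)" by (simp only: e'_def)
        then show ?thesis by simp
      qed
      also have "\<dots> \<le> e * 1" by (intro mult_left_mono) (use e nz in auto)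
      finally show "inner (v - g) (z - x) \<le> 0 + e" by simp
    qed
  qed
next
  assume R: ?R
  have x: "x \<in> P" by (rule normal_coneD(1)[OF R])
  have "\<exists>d>0. \<forall>z. norm (z - x) < d \<longrightarrow> z \<in> P \<longrightarrow> q x + inner v (z - x) - e * norm (z - x) \<le> q z"
    if e: "e > 0" for e
  proof -
    obtain d where d: "d > 0" "\<And>w. norm (w - x) < d \<Longrightarrow>
          norm (q w - q x - inner g (w - x)) \<le> e * norm (w - x)"
      using q e unfolding has_derivative_at_alt by blast
    have "q x + inner v (z - x) - e * norm (z - x) \<le> q z" if "norm (z - x) < d" "z \<in> P" for z
      using d(2)[OF that(1)] normal_coneD(2)[OF R that(2)] by (simp add: inner_diff_left)
    then show ?thesis using d(1) by blast
  qed
  moreover have "(\<forall>z. norm (z - x) < d \<longrightarrow> z \<in> P \<longrightarrow> Q z) \<longleftrightarrow> (\<forall>z. z \<in> P \<longrightarrow> norm (z - x) < d \<longrightarrow> Q z)" for d Q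
    by blast
  ultimately show ?L using x unfolding frechet_subdiff_def by auto
qed

text \<open>The normal cone of a closed convex set has a closed graph, so limits add no new
  subgradients; conversely constant sequences suffice. Both the inexactness criterion and the KL
  inequality are thereby read as statements about normals of \<open>P\<close>.\<close>

lemma limiting_subdiff_restrict:
  fixes q :: "'a::euclidean_space \<Rightarrow> real"
  assumes P: "convex P" "closed P" and q: "\<And>x. (q has_derivative (\<lambda>h. inner (g x) h)) (at x)"
    and g: "continuous_on UNIV g"
  shows "v \<in> limiting_subdiff (\<lambda>z. if z \<in> P then ereal (q z) else \<infinity>) x \<longleftrightarrow> v - g x \<in> normal_cone P x"
    (is "?L \<longleftrightarrow> ?R")
proof
  assume ?L
  then obtain xs vs where xs: "xs \<longlonglongrightarrow> x" and vs: "vs \<longlonglongrightarrow> v"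
    and "\<And>k. vs k \<in> frechet_subdiff (\<lambda>z. if z \<in> P then ereal (q z) else \<infinity>) (xs k)"
    unfolding limiting_subdiff_def by blast
  then have N: "\<And>k. vs k - g (xs k) \<in> normal_cone P (xs k)"
    using frechet_subdiff_restrict[OF P(1) q] by blast
  have "x \<in> P" using closed_sequentially[OF P(2) _ xs] normal_coneD(1)[OF N] by blast
  then show ?R
  proof (rule normal_coneI)
    fix z assume z: "z \<in> P"
    have "(\<lambda>k. g (xs k)) \<longlonglongrightarrow> g x" using continuous_on_tendsto_compose[OF g xs] by simp
    then have "(\<lambda>k. inner (vs k - g (xs k)) (z - xs k)) \<longlonglongrightarrow> inner (v - g x) (z - x)"
      by (intro tendsto_intros xs vs)
    then show "inner (v - g x) (z - x) \<le> 0"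
      by (rule LIMSEQ_le_const2) (use normal_coneD(2)[OF N z] in auto)
  qed
next
  assume ?R
  then have "v \<in> frechet_subdiff (\<lambda>z. if z \<in> P then ereal (q z) else \<infinity>) x"
    using frechet_subdiff_restrict[OF P(1) q] by blast
  then show ?L unfolding limiting_subdiff_def mem_Collect_eq
    by (intro exI[of _ "\<lambda>_. x"] exI[of _ "\<lambda>_. v"]) simp
qed

text \<open>The hypothesis says that near \<open>xs\<close> the set is locally conical, as polyhedra are.\<close>
lemma normal_cone_near:
  assumes loc: "2 *\<^sub>R z - xs \<in> P" and xs: "xs \<in> P" and w: "w \<in> normal_cone P z"
  shows "w \<in> normal_cone P xs" and "inner w (z - xs) = 0"
proof -
  have "inner w (2 *\<^sub>R z - xs - z) \<le> 0" "inner w (xs - z) \<le> 0"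
    using normal_coneD(2)[OF w] loc xs by blast+
  then show 0: "inner w (z - xs) = 0"
    by (simp add: inner_diff_right)
  show "w \<in> normal_cone P xs"
  proof (rule normal_coneI[OF xs])
    fix z' assume "z' \<in> P"
    then show "inner w (z' - xs) \<le> 0"
      using normal_coneD(2)[OF w, of z'] 0 by (simp add: inner_diff_right)
  qed
qed

text \<open>A linear form that is nonpositive on a set and vanishes at a relative interior point
  vanishes on the whole set; the normals near \<open>p\<close> are relative interior points.\<close>
lemma face_identification:
  fixes P :: "'a::euclidean_space set"
  assumes xs: "xs \<in> P" and p: "p \<in> rel_interior (normal_cone P xs)"
  obtains d where "d > 0"
    "\<And>z w v. z \<in> P \<Longrightarrow> 2 *\<^sub>R z - xs \<in> P \<Longrightarrow> w \<in> normal_cone P z \<Longrightarrow> norm (w - p) < d \<Longrightarrow>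
      v \<in> normal_cone P xs \<Longrightarrow> inner v (z - xs) = 0"
proof -
  let ?K = "normal_cone P xs"
  obtain d where d: "d > 0" "ball p d \<inter> affine hull ?K \<subseteq> ?K"
    using p unfolding mem_rel_interior_ball by blast
  show thesis
  proof (rule that)
    show "d > 0" by (rule d)
    fix z w v assume z: "z \<in> P" "2 *\<^sub>R z - xs \<in> P" and w: "w \<in> normal_cone P z"
      and wp: "norm (w - p) < d" and v: "v \<in> ?K"
    have wK: "w \<in> ?K" and w0: "inner w (z - xs) = 0"
      using normal_cone_near[OF z(2) xs w] by auto
    \<comment> \<open>The point \<open>w\<close> is pushed away from \<open>v\<close> by so little
      that the result \<open>w'\<close> stays in the ball around \<open>p\<close>, hence in the
      cone. As \<open>w\<close> is orthogonal to \<open>z - xs\<close>, the sign of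
      \<open>inner w' (z - xs)\<close> is opposite to that of
      \<open>inner v (z - xs)\<close>.\<close>
    define s where "s = (d - norm (w - p)) / (2 * (norm (w - v) + 1))"
    have nz: "0 < norm (w - v) + 1" using norm_ge_zero[of "w - v"] by linarith
    have s: "s > 0" using wp nz by (simp add: s_def)
    define w' where "w' = (1 + s) *\<^sub>R w + (- s) *\<^sub>R v"
    have "w' \<in> affine hull ?K"
      unfolding w'_def by (rule mem_affine[OF affine_affine_hull]) (use wK v hull_inc in auto)
    moreover have "w' \<in> ball p d"
    proof -
      have "s * norm (w - v) \<le> s * (norm (w - v) + 1)" using s by simp
      also have "\<dots> < d - norm (w - p)" 
      proof -
        have "s * (norm (w - v) + 1) = (d - norm (w - p)) / 2" using nz by (simp add: s_def field_simps)
        then show ?thesis using wp by simp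
      qed
      finally have "s * norm (w - v) < d - norm (w - p)" .
      moreover have "w' - p = (w - p) + s *\<^sub>R (w - v)" by (simp add: w'_def algebra_simps)
      then have "norm (w' - p) \<le> norm (w - p) + s * norm (w - v)"
        using norm_triangle_ineq[of "w - p" "s *\<^sub>R (w - v)"] s by (simp only: norm_scaleR abs_of_pos)
      ultimately show ?thesis by (simp add: dist_norm norm_minus_commute)
    qed
    ultimately have "w' \<in> ?K" using d by blast
    then have "inner w' (z - xs) \<le> 0" using normal_coneD(2) z(1) by blast
    then have "0 \<le> s * inner v (z - xs)" using w0 by (simp add: w'_def inner_add_left inner_diff_left)
    then have "0 \<le> inner v (z - xs)" using s by (simp add: zero_le_mult_iff)
    moreover have "inner v (z - xs) \<le> 0" using normal_coneD(2)[OF v] z(1) by blast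
    ultimately show "inner v (z - xs) = 0" by simp
  qed
qed

lemma l0_mono: "supp x \<subseteq> supp z \<Longrightarrow> l0 x \<le> l0 z"
  by (simp add: l0_def card_mono)

lemma gfin_mono:
  assumes "lam1 \<ge> 0" "lam2 \<ge> 0" "supp x \<subseteq> supp z" "supp (B *v x) \<subseteq> supp (B *v z)"
  shows "gfin B lam1 lam2 x \<le> gfin B lam1 lam2 z"
  unfolding gfin_def using assms by (intro add_mono mult_left_mono l0_mono) auto

lemma box_set_cbox: "box_set l u = cbox l u"
  by (auto simp: box_set_def mem_box_cart)

lemma Pi_set_eq_Int:
  "Pi_set B l u z = box_set l u \<inter> {x. \<forall>i. i \<notin> supp z \<longrightarrow> x $ i = 0} \<inter>
     {x. \<forall>i. i \<notin> supp (B *v z) \<longrightarrow> (B *v x) $ i = 0}"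
  unfolding Pi_set_def supp_def by auto

lemma convex_Pi_set:
  fixes B :: "real^'n^'p"
  shows "convex (Pi_set B l u z)"
proof (rule convexI)
  fix x y :: "real^'n" and a b :: real
  assume x: "x \<in> Pi_set B l u z" and y: "y \<in> Pi_set B l u z" and ab: "0 \<le> a" "0 \<le> b" "a + b = 1"
  have "a *\<^sub>R x + b *\<^sub>R y \<in> box_set l u"
    using x y ab convexD[OF convex_box(1)[of l u]] unfolding box_set_cbox[symmetric] Pi_set_def by blast
  then show "a *\<^sub>R x + b *\<^sub>R y \<in> Pi_set B l u z"
    using x y by (auto simp: Pi_set_eq_Int matrix_vector_right_distrib matrix_vector_mult_scaleR)
qed

lemma compact_Pi_set:
  fixes B :: "real^'n^'p"
  shows "compact (Pi_set B l u z)"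
proof -
  have "closed {x :: real^'n. \<forall>i. i \<notin> supp z \<longrightarrow> x $ i = 0}"
    by (intro closed_Collect_all closed_Collect_imp closed_Collect_eq continuous_on_const
        continuous_on_component continuous_on_id) auto
  moreover have "continuous_on UNIV (\<lambda>x::real^'n. (B *v x) $ i)" for i
    by (intro continuous_on_component linear_continuous_on matrix_vector_mul_bounded_linear)
  then have "closed {x :: real^'n. \<forall>i. i \<notin> supp (B *v z) \<longrightarrow> (B *v x) $ i = 0}"
    by (intro closed_Collect_all closed_Collect_imp closed_Collect_eq continuous_on_const) auto
  ultimately show ?thesis
    unfolding Pi_set_eq_Int box_set_cbox by (intro compact_Int_closed compact_cbox)
qed

text \<open>Doubling the displacement from \<open>xs\<close> preserves the homogeneous linear
  equations, which hold at \<open>z\<close> and at \<open>xs\<close>. A bound active at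
  \<open>xs\<close> is preserved because \<open>z\<close> already lies on its feasible side; an
  inactive one is preserved by continuity.\<close>

lemma Pi_set_locally_conical:
  assumes xs: "xs \<in> Pi_set B l u z0"
  obtains d where "d > 0"
    "\<And>z. z \<in> Pi_set B l u z0 \<Longrightarrow> norm (z - xs) < d \<Longrightarrow> 2 *\<^sub>R z - xs \<in> Pi_set B l u z0"
proof -
  have lim: "((\<lambda>z. 2 * z $ i - xs $ i) \<longlongrightarrow> 2 * xs $ i - xs $ i) (at xs)" for i
    by (intro tendsto_intros)
  have box: "l $ i \<le> xs $ i" "xs $ i \<le> u $ i" for i
    using xs by (auto simp: Pi_set_def box_set_def)
  have "eventually (\<lambda>z. z \<in> box_set l u \<longrightarrow> l $ i \<le> 2 * z $ i - xs $ i) (at xs)" for i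
  proof (cases "l $ i = xs $ i")
    case True
    then have "l $ i \<le> 2 * z $ i - xs $ i" if "z \<in> box_set l u" for z
      using that[unfolded box_set_def, THEN CollectD, rule_format, of i] by linarith
    then show ?thesis by (intro always_eventually) auto
  next
    case False
    then have "l $ i < 2 * xs $ i - xs $ i" using box(1)[of i] by simp
    from order_tendstoD(1)[OF lim this] show ?thesis by eventually_elim auto
  qed
  moreover have "eventually (\<lambda>z. z \<in> box_set l u \<longrightarrow> 2 * z $ i - xs $ i \<le> u $ i) (at xs)" for i
  proof (cases "u $ i = xs $ i")
    case True
    then have "2 * z $ i - xs $ i \<le> u $ i" if "z \<in> box_set l u" for z
      using that[unfolded box_set_def, THEN CollectD, rule_format, of i] by linarith
    then show ?thesis by (intro always_eventually) auto
  next
    case False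
    then have "2 * xs $ i - xs $ i < u $ i" using box(2)[of i] by simp
    from order_tendstoD(2)[OF lim this] show ?thesis by eventually_elim auto
  qed
  ultimately have "eventually (\<lambda>z. \<forall>i. z \<in> box_set l u \<longrightarrow> l $ i \<le> 2 * z $ i - xs $ i \<and> 2 * z $ i - xs $ i \<le> u $ i) (at xs)"
    by (auto simp: imp_conjR intro!: eventually_all_finite eventually_conj)
  then obtain d where d: "d > 0" "\<And>z. z \<noteq> xs \<Longrightarrow> dist z xs < d \<Longrightarrow> z \<in> box_set l u \<Longrightarrow>
      \<forall>i. l $ i \<le> 2 * z $ i - xs $ i \<and> 2 * z $ i - xs $ i \<le> u $ i"
    unfolding eventually_at by blast
  show thesis
  proof (rule that[OF d(1)])
    fix z assume z: "z \<in> Pi_set B l u z0" "norm (z - xs) < d"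
    have "2 *\<^sub>R z - xs \<in> box_set l u" if "z \<noteq> xs"
      using d(2)[OF that] z by (simp add: dist_norm box_set_def Pi_set_def)
    moreover have "2 *\<^sub>R xs - xs = xs" by (simp add: scaleR_2)
    ultimately have "2 *\<^sub>R z - xs \<in> box_set l u" using xs by (cases "z = xs") (auto simp: Pi_set_def)
    then show "2 *\<^sub>R z - xs \<in> Pi_set B l u z0"
      using z(1) xs by (auto simp: Pi_set_eq_Int matrix_vector_mult_diff_distrib matrix_vector_mult_scaleR)
  qed
qed

section \<open>Proximal steps, line search and trapping near an accumulation point\<close>

text \<open>Completing the square. The last summand is independent of \<open>w\<close>, so the
  proximal problem minimises the linear model of \<open>f\<close> plus \<open>mb / 2\<close> times
  the squared distance plus \<open>g\<close>.\<close>

lemma prox_objective: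
  fixes w x g :: "'a::real_inner"
  assumes "mb > (0::real)"
  shows "1 / (2 * (1 / mb)) * (norm (w - (x - (1 / mb) *\<^sub>R g)))\<^sup>2
    = inner g (w - x) + mb / 2 * (norm (w - x))\<^sup>2 + (norm g)\<^sup>2 / (2 * mb)"
proof -
  have "(norm (h + (1 / mb) *\<^sub>R g))\<^sup>2 = (norm h)\<^sup>2 + 2 / mb * inner g h + (norm g)\<^sup>2 / mb\<^sup>2" for h
    unfolding power2_norm_eq_inner
    by (simp add: inner_add_left inner_add_right inner_commute power2_eq_square)
  moreover have "w - (x - (1 / mb) *\<^sub>R g) = (w - x) + (1 / mb) *\<^sub>R g" by simp
  ultimately have "(norm (w - (x - (1 / mb) *\<^sub>R g)))\<^sup>2
      = (norm (w - x))\<^sup>2 + 2 / mb * inner g (w - x) + (norm g)\<^sup>2 / mb\<^sup>2"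
    by (simp only:)
  then show ?thesis using assms by (simp add: field_simps power2_eq_square)
qed

lemma prox_set_iff:
  assumes "mb > 0"
  shows "z \<in> prox_set B lam1 lam2 l u (1 / mb) (x - (1 / mb) *\<^sub>R g) \<longleftrightarrow> z \<in> box_set l u \<and>
    (\<forall>w\<in>box_set l u. inner g (z - x) + mb / 2 * (norm (z - x))\<^sup>2 + gfin B lam1 lam2 z
        \<le> inner g (w - x) + mb / 2 * (norm (w - x))\<^sup>2 + gfin B lam1 lam2 w)"
  unfolding prox_set_def mem_Collect_eq prox_objective[OF assms] by (simp add: add_ac)

text \<open>There are only finitely many sets \<open>Pi_set\<close>; minimising the quadratic part on each of them
  leaves finitely many candidates, which sidesteps lower semicontinuity of the zero norm.\<close>
lemma prox_set_nonempty:
  fixes B :: "real^'n^'p"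
  assumes lu: "\<And>i. l $ i \<le> 0" "\<And>i. 0 \<le> u $ i" and lam: "lam1 \<ge> 0" "lam2 \<ge> 0" and c: "c > 0"
  shows "prox_set B lam1 lam2 l u c z \<noteq> {}"
proof -
  define q where "q w = 1 / (2 * c) * (norm (w - z))\<^sup>2" for w :: "real^'n"
  define J where "J = Pi_set B l u ` box_set l u"
  have "J \<subseteq> (\<lambda>(S, T). {x \<in> box_set l u. supp x \<subseteq> S \<and> supp (B *v x) \<subseteq> T}) ` UNIV"
    unfolding J_def Pi_set_def by auto
  then have finJ: "finite J" by (rule finite_subset) simp
  have "0 \<in> box_set l u" using lu by (simp add: box_set_def)
  then have neJ: "J \<noteq> {}" unfolding J_def by blast
  have "\<exists>a. a \<in> Q \<and> (\<forall>w\<in>Q. q a \<le> q w)" if QJ: "Q \<in> J" for Q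
  proof -
    obtain v where v: "v \<in> box_set l u" "Q = Pi_set B l u v" using QJ unfolding J_def by blast
    then have "Q \<noteq> {}" by (auto simp: Pi_set_def)
    moreover have "compact Q" using v compact_Pi_set by blast
    moreover have "continuous_on Q q" unfolding q_def by (intro continuous_intros)
    ultimately show ?thesis using continuous_attains_inf[of Q q] by blast
  qed
  then obtain a where a: "\<And>Q. Q \<in> J \<Longrightarrow> a Q \<in> Q" "\<And>Q w. Q \<in> J \<Longrightarrow> w \<in> Q \<Longrightarrow> q (a Q) \<le> q w"
    by metis
  define h where "h R = q (a R) + gfin B lam1 lam2 (a R)" for R
  have "Min (h ` J) \<in> h ` J" using finJ neJ by (intro Min_in) auto
  then obtain Q where Q: "Q \<in> J" "Min (h ` J) = h Q" by blast
  have hQ: "h Q \<le> h R" if "R \<in> J" for R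
    unfolding Q(2)[symmetric] using finJ that by (intro Min_le) auto
  have "a Q \<in> prox_set B lam1 lam2 l u c z"
    unfolding prox_set_def q_def[symmetric]
  proof (intro CollectI conjI ballI)
    have "R \<subseteq> box_set l u" if "R \<in> J" for R using that by (auto simp: J_def Pi_set_def)
    then show "a Q \<in> box_set l u" using a(1) Q(1) by blast
    fix w assume w: "w \<in> box_set l u"
    then have wJ: "Pi_set B l u w \<in> J" "w \<in> Pi_set B l u w" unfolding J_def by (blast, simp add: Pi_set_def)
    have "gfin B lam1 lam2 (a (Pi_set B l u w)) \<le> gfin B lam1 lam2 w"
      using a(1)[OF wJ(1)] lam by (intro gfin_mono) (auto simp: Pi_set_def)
    then show "q (a Q) + gfin B lam1 lam2 (a Q) \<le> q w + gfin B lam1 lam2 w"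
      using hQ[OF wJ(1)] a(2)[OF wJ] unfolding h_def by linarith
  qed
  then show ?thesis by blast
qed

text \<open>On \<open>Pi_set B l u z\<close> the zero norms are largest at \<open>z\<close>, so there a proximal point is a
  Euclidean projection.\<close>
lemma prox_set_normal:
  fixes B :: "real^'n^'p"
  assumes z: "z \<in> prox_set B lam1 lam2 l u (1 / mb) (x - (1 / mb) *\<^sub>R g)"
    and mb: "mb > 0" and lam: "lam1 \<ge> 0" "lam2 \<ge> 0"
  shows "mb *\<^sub>R (x - z) - g \<in> normal_cone (Pi_set B l u z) z"
proof -
  let ?P = "Pi_set B l u z" and ?a = "x - (1 / mb) *\<^sub>R g"
  have zP: "z \<in> ?P" using z by (simp add: prox_set_def Pi_set_def)
  have "dist ?a z \<le> dist ?a w" if w: "w \<in> ?P" for w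
  proof -
    have "gfin B lam1 lam2 w \<le> gfin B lam1 lam2 z"
      using w lam by (intro gfin_mono) (auto simp: Pi_set_def)
    moreover have "1 / (2 * (1 / mb)) * (norm (z - ?a))\<^sup>2 + gfin B lam1 lam2 z
        \<le> 1 / (2 * (1 / mb)) * (norm (w - ?a))\<^sup>2 + gfin B lam1 lam2 w"
      using z w by (auto simp: prox_set_def Pi_set_def)
    ultimately have "mb * (norm (z - ?a))\<^sup>2 \<le> mb * (norm (w - ?a))\<^sup>2" by simp
    then have "(norm (z - ?a))\<^sup>2 \<le> (norm (w - ?a))\<^sup>2" using mb by (rule mult_left_le_imp_le)
    then have "norm (z - ?a) \<le> norm (w - ?a)" by (rule power2_le_imp_le) simp
    then show ?thesis by (simp add: dist_norm norm_minus_commute)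
  qed
  then have "inner (?a - z) (w - z) \<le> 0" if "w \<in> ?P" for w
    using any_closest_point_dot[OF convex_Pi_set compact_imp_closed[OF compact_Pi_set] zP that] by blast
  then have "inner (mb *\<^sub>R (?a - z)) (w - z) \<le> 0" if "w \<in> ?P" for w
    using that mb by (simp add: mult_le_0_iff)
  moreover have "mb *\<^sub>R (?a - z) = mb *\<^sub>R (x - z) - g" using mb by (simp add: algebra_simps)
  ultimately show ?thesis using zP by (intro normal_coneI) auto
qed

text \<open>The mean value theorem on the segment, combined with the Lipschitz bound for the
  gradient. The gradient at the intermediate point is estimated over the full length, hence the
  constant \<open>L\<close> in place of \<open>L / 2\<close>.\<close>

lemma descent_estimate:
  fixes f :: "real^'n \<Rightarrow> real"
  assumes f_grad: "\<And>z. (f has_derivative (\<lambda>h. inner (df z) h)) (at z)"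
    and f_hess: "\<And>z. (df has_derivative (\<lambda>h. Hf z *v h)) (at z)"
    and S: "convex S" "x \<in> S" "z \<in> S"
    and L: "\<And>w h. w \<in> S \<Longrightarrow> norm (Hf w *v h) \<le> L * norm h"
  shows "f z \<le> f x + inner (df x) (z - x) + L * (norm (z - x))\<^sup>2"
proof -
  have L0: "L * norm (z - x) \<ge> 0" using L[OF S(2)] norm_ge_zero order_trans by blast
  have seg: "x + s *\<^sub>R (z - x) \<in> S" if "0 \<le> s" "s \<le> 1" for s
    using convexD_alt[OF S that] by (simp add: algebra_simps)
  have lip: "norm (df w - df x) \<le> L * norm (w - x)" if "w \<in> S" for w
  proof (rule differentiable_bound[OF S(1)])
    show "(df has_derivative (\<lambda>h. Hf y *v h)) (at y within S)" for y
      by (rule has_derivative_at_withinI[OF f_hess])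
    show "onorm (\<lambda>h. Hf y *v h) \<le> L" if "y \<in> S" for y
      by (rule onorm_le) (use L[OF that] in auto)
  qed (use S that in auto)
  have der: "((\<lambda>a. f (x + a *\<^sub>R (z - x))) has_real_derivative inner (df (x + a *\<^sub>R (z - x))) (z - x)) (at a)" for a
  proof -
    have "((\<lambda>a. x + a *\<^sub>R (z - x)) has_derivative (\<lambda>t. t *\<^sub>R (z - x))) (at a)"
      by (auto intro!: derivative_eq_intros)
    from has_derivative_compose[OF this f_grad] show ?thesis
      by (simp add: has_field_derivative_def mult_commute_abs)
  qed
  obtain s where s: "0 < s" "s < 1"
    "f (x + 1 *\<^sub>R (z - x)) - f (x + 0 *\<^sub>R (z - x)) = (1 - 0) * inner (df (x + s *\<^sub>R (z - x))) (z - x)"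
    using MVT2[OF zero_less_one der] by auto
  have "inner (df (x + s *\<^sub>R (z - x)) - df x) (z - x) \<le> norm (df (x + s *\<^sub>R (z - x)) - df x) * norm (z - x)"
    by (rule norm_cauchy_schwarz)
  also have "\<dots> \<le> (L * norm (z - x)) * norm (z - x)"
  proof (rule mult_right_mono)
    have "norm (df (x + s *\<^sub>R (z - x)) - df x) \<le> L * norm (s *\<^sub>R (z - x))"
      using lip[OF seg[of s]] s by simp
    also have "\<dots> = s * (L * norm (z - x))" using s by simp
    also have "\<dots> \<le> 1 * (L * norm (z - x))" using s L0 by (intro mult_right_mono) auto
    finally show "norm (df (x + s *\<^sub>R (z - x)) - df x) \<le> L * norm (z - x)" by simp
  qed simp
  finally show ?thesis using s(3) by (simp add: inner_diff_left power2_eq_square)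
qed

text \<open>Comparing a proximal point with the competitor \<open>x\<close> itself:
  \<open>c / 2\<close> covers both the curvature \<open>L\<close> of \<open>f\<close> and the
  demanded decrease \<open>alpha / 2\<close>. This is what bounds the backtracking.\<close>

lemma PG_accept_large:
  fixes B :: "real^'n^'p"
  assumes lu: "\<And>i. l $ i \<le> 0" "\<And>i. 0 \<le> u $ i" and lam: "lam1 \<ge> 0" "lam2 \<ge> 0"
    and x: "x \<in> box_set l u" and c: "c > 0" "2 * L + alpha \<le> c"
    and L: "\<And>z. z \<in> box_set l u \<Longrightarrow> f z \<le> f x + inner (df x) (z - x) + L * (norm (z - x))\<^sup>2"
  shows "\<exists>z. PG_accept f df B lam1 lam2 l u alpha c x z"
proof -
  obtain z where z: "z \<in> prox_set B lam1 lam2 l u (1 / c) (x - (1 / c) *\<^sub>R df x)"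
    using prox_set_nonempty[OF lu lam, of "1 / c"] c by fastforce
  have "inner (df x) (z - x) + c / 2 * (norm (z - x))\<^sup>2 + gfin B lam1 lam2 z \<le> gfin B lam1 lam2 x"
    using z x c unfolding prox_set_iff[OF c(1)] by fastforce
  moreover have "f z \<le> f x + inner (df x) (z - x) + L * (norm (z - x))\<^sup>2"
    using z L unfolding prox_set_iff[OF c(1)] by blast
  moreover have "(L + alpha / 2) * (norm (z - x))\<^sup>2 \<le> c / 2 * (norm (z - x))\<^sup>2"
    using c by (intro mult_right_mono) auto
  ultimately have "Fval f B lam1 lam2 z \<le> Fval f B lam1 lam2 x - alpha / 2 * (norm (x - z))\<^sup>2"
    by (simp add: Fval_def norm_minus_commute algebra_simps)
  then show ?thesis using z unfolding PG_accept_def by blast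
qed

text \<open>For \<open>t = 0\<close> the step is 1. Otherwise the last rejected step,
  \<open>beta\<close> to the power \<open>t - 1\<close>, violates the Armijo test although the
  quadratic estimate holds there, which bounds it from below; one more factor \<open>beta\<close>
  gives the accepted step.\<close>

lemma line_search_lower:
  fixes x d :: "'a::real_inner"
  assumes d: "d \<noteq> 0" and L: "L > 0" and beta: "0 < beta" "beta < 1" and rho: "rho < 1"
    and desc: "inner g d \<le> - (e / 2) * (norm d)\<^sup>2"
    and est: "\<And>s. 0 \<le> s \<Longrightarrow> s \<le> 1 \<Longrightarrow> f (x + s *\<^sub>R d) \<le> f x + s * inner g d + L * s\<^sup>2 * (norm d)\<^sup>2"
    and fail: "\<And>t'. t' < t \<Longrightarrow> \<not> f (x + beta ^ t' *\<^sub>R d) \<le> f x + rho * beta ^ t' * inner g d"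
  shows "min 1 (beta * (1 - rho) * e / (2 * L)) \<le> beta ^ t"
proof (cases t)
  case (Suc j)
  define s where "s = beta ^ j"
  have s: "0 < s" "s \<le> 1" using beta by (auto simp: s_def power_le_one)
  have "f x + rho * s * inner g d < f (x + s *\<^sub>R d)" using fail[of j] Suc by (simp add: s_def)
  also have "\<dots> \<le> f x + s * inner g d + L * s\<^sup>2 * (norm d)\<^sup>2" using est s by simp
  finally have "s * ((1 - rho) * (- inner g d)) < s * (L * s * (norm d)\<^sup>2)"
    by (simp add: algebra_simps power2_eq_square)
  then have "(1 - rho) * (- inner g d) < L * s * (norm d)\<^sup>2"
    using mult_less_cancel_left_pos[OF s(1)] by blast
  moreover have "(1 - rho) * (e / 2 * (norm d)\<^sup>2) \<le> (1 - rho) * (- inner g d)"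
    using desc rho by (intro mult_left_mono) auto
  ultimately have "((1 - rho) * e / 2) * (norm d)\<^sup>2 < (L * s) * (norm d)\<^sup>2"
    by (simp only: mult.assoc times_divide_eq_left times_divide_eq_right)
  then have "(1 - rho) * e / 2 < L * s" using d by simp
  then have "(1 - rho) * e / (2 * L) < s" using L by (simp add: field_simps)
  then have "beta * ((1 - rho) * e / (2 * L)) < beta * s"
    by (rule mult_strict_left_mono[OF _ beta(1)])
  then show ?thesis using Suc by (simp add: s_def mult.assoc)
qed simp

text \<open>Monotonicity of the normal cone between \<open>y\<close> and \<open>xb\<close>, tested
  on \<open>y - xb\<close>, which is the Newton direction \<open>y - x\<close> plus the proximal
  displacement \<open>x - xb\<close>. Here \<open>v\<close> is the inexactness and \<open>w\<close>
  the curvature term of the quadratic model.\<close>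

lemma step_estimates:
  fixes x xb y g v :: "'a::euclidean_space"
  assumes y: "v - g - w \<in> normal_cone P y" and xb: "mb *\<^sub>R (x - xb) - g \<in> normal_cone P xb"
    and r: "r = norm (mb *\<^sub>R (x - xb))" "norm v \<le> 3/4 * r"
    and mb: "0 < m0" "m0 \<le> mb" "mb \<le> M" and Gam: "\<Gamma> \<ge> 0"
    and w: "norm w \<le> \<Gamma> * norm (y - x)"
  shows "r \<le> 5 * (7/4 * M + \<Gamma>) * norm (y - x)"
    and "inner w (y - x) \<le> r * ((7/4 + \<Gamma> / m0) * norm (y - x) + r / m0)"
proof -
  define d where "d = y - x"
  define q where "q = x - xb"
  have mb0: "mb > 0" and M: "M > 0" using mb by auto
  have rq: "r = mb * norm q" using r(1) mb0 by (simp add: q_def)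
  have r0: "r \<ge> 0" by (simp add: r(1))
  have "0 \<le> inner (v - g - w - (mb *\<^sub>R q - g)) (d + q)"
    using normal_cone_monotone[OF y xb] by (simp add: d_def q_def)
  then have mono: "inner w d + mb * (norm q)\<^sup>2 \<le> inner v d + inner v q - inner w q - mb * inner q d"
    by (simp add: inner_diff_left inner_add_right power2_norm_eq_inner algebra_simps)
  have vd: "inner v d \<le> 3/4 * r * norm d"
    using norm_cauchy_schwarz[of v d] mult_right_mono[OF r(2), of "norm d"] by simp
  have vq: "inner v q \<le> 3/4 * r * norm q"
    using norm_cauchy_schwarz[of v q] mult_right_mono[OF r(2), of "norm q"] by simp
  have wq: "- inner w q \<le> \<Gamma> * norm d * norm q"
    using norm_cauchy_schwarz[of "- w" q] mult_right_mono[OF w[folded d_def], of "norm q"] by simp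
  have wd: "- inner w d \<le> \<Gamma> * norm d * norm d"
    using norm_cauchy_schwarz[of "- w" d] mult_right_mono[OF w[folded d_def], of "norm d"] by simp
  have qd: "- mb * inner q d \<le> r * norm d"
    using mult_left_mono[OF norm_cauchy_schwarz[of "- q" d], of mb] mb0 by (simp add: rq)
  have qq: "mb * (norm q)\<^sup>2 = r * norm q" by (simp add: rq power2_eq_square)
  \<comment> \<open>The inexactness takes \<open>3/4\<close> of the quadratic term
    \<open>mb * (norm q)\<^sup>2\<close> and leaves \<open>1/4\<close>; the factor
    \<open>7/4\<close> adds \<open>3/4\<close> from \<open>v\<close> and 1 from the cross
    term.\<close>
  have up: "inner w d + 1/4 * (r * norm q) \<le> 7/4 * (r * norm d) + \<Gamma> * norm d * norm q"
    using mono vd vq wq qd qq by simp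
  show "inner w (y - x) \<le> r * ((7/4 + \<Gamma> / m0) * norm (y - x) + r / m0)"
  proof -
    have "norm q * m0 \<le> r" unfolding rq using mb by (subst mult.commute, intro mult_right_mono) auto
    then have "norm q \<le> r / m0" using mb by (simp add: field_simps)
    then have "\<Gamma> * norm d * norm q \<le> \<Gamma> * norm d * (r / m0)" using Gam by (intro mult_left_mono) auto
    moreover have "0 \<le> r * norm q" "0 \<le> r * (r / m0)" using r0 mb by auto
    ultimately have "inner w d \<le> 7/4 * (r * norm d) + \<Gamma> * norm d * (r / m0) + r * (r / m0)"
      using up by linarith
    then show ?thesis by (simp add: d_def algebra_simps)
  qed
  show "r \<le> 5 * (7/4 * M + \<Gamma>) * norm (y - x)"
  proof (rule ccontr)
    \<comment> \<open>With \<open>D = norm d\<close> the estimates give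
      \<open>r * r \<le> 4 * a * D * r + 4 * (a * D) * (a * D)\<close>. The factor 5 works because
      it exceeds 2 + 2 sqrt 2, the positive root of \<open>s * s = 4 * s + 4\<close>.\<close>
    define a where "a = 7/4 * M + \<Gamma>"
    define D where "D = norm d"
    have D: "D \<ge> 0" by (simp add: D_def)
    have a: "a > 0" using M Gam by (simp add: a_def)
    assume "\<not> r \<le> 5 * (7/4 * M + \<Gamma>) * norm (y - x)"
    then have big: "5 * a * D < r" by (simp add: a_def D_def d_def)
    have rpos: "r > 0" using big a D by (smt (verit) mult_nonneg_nonneg)
    have "1/4 * (r * norm q) \<le> 7/4 * (r * D) + \<Gamma> * D * norm q + \<Gamma> * D * D"
      using up wd by (simp add: D_def)
    then have "mb * (1/4 * (r * norm q)) \<le> mb * (7/4 * (r * D) + \<Gamma> * D * norm q + \<Gamma> * D * D)"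
      using mb0 by simp
    then have "1/4 * r * r \<le> mb * (7/4 * (r * D) + \<Gamma> * D * D) + \<Gamma> * D * r"
      by (simp add: rq algebra_simps)
    also have "\<dots> \<le> M * (7/4 * (r * D) + \<Gamma> * D * D) + \<Gamma> * D * r"
      using mb r0 D Gam by (intro add_right_mono mult_right_mono) auto
    also have "\<dots> = a * (r * D) + \<Gamma> * M * (D * D)" by (simp add: a_def algebra_simps)
    also have "\<dots> \<le> a * (r * D) + a * a * (D * D)"
      using M Gam D by (intro add_left_mono mult_right_mono mult_mono) (auto simp: a_def)
    finally have 1: "r * r \<le> 4 * a * D * r + 4 * (a * D) * (a * D)" by (simp add: algebra_simps)
    have "(5 * a * D) * r \<le> r * r" using big rpos by (intro mult_right_mono) auto
    then have 2: "(a * D) * r \<le> 4 * (a * D) * (a * D)" using 1 by simp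
    show False
    proof (cases "D = 0")
      case True
      then show False using 1 mult_pos_pos[OF rpos rpos] by simp
    next
      case False
      then have "a * D > 0" using a D by simp
      moreover have "(a * D) * r \<le> (a * D) * (4 * (a * D))" using 2 by simp
      ultimately have "r \<le> 4 * (a * D)" by (metis mult_left_le_imp_le)
      then show False using big \<open>a * D > 0\<close> by simp
    qed
  qed
qed

text \<open>Start at an iterate close to \<open>xs\<close> whose \<open>Phi\<close> is small. As
  long as the iterates stay in the ball, telescoping bounds the travelled length by less than
  \<open>d / 2\<close>, so they never leave it and the total length is finite. Convergence follows,
  with limit the accumulation point.\<close>

lemma trapping:
  fixes x :: "nat \<Rightarrow> 'a::euclidean_space"
  assumes acc: "xs \<in> acc_points x" and d: "d > 0" and c: "c > 0"
    and Phi: "\<And>k. k \<ge> K \<Longrightarrow> 0 \<le> Phi k" "Phi \<longlonglongrightarrow> (0::real)"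
    and step: "\<And>k. k \<ge> K \<Longrightarrow> dist (x k) xs < d \<Longrightarrow>
        c * norm (x (Suc k) - x k) \<le> Phi k - Phi (Suc k)"
  shows "summable (\<lambda>k. norm (x (Suc k) - x k))" and "x \<longlonglongrightarrow> xs"
proof -
  obtain r where r: "strict_mono r" "(x \<circ> r) \<longlonglongrightarrow> xs" using acc by (auto simp: acc_points_def)
  have "eventually (\<lambda>k. Phi k < c * (d / 2)) sequentially"
    using order_tendstoD(2)[OF Phi(2), of "c * (d / 2)"] c d by simp
  then obtain K1 where K1: "\<And>k. k \<ge> K1 \<Longrightarrow> Phi k < c * (d / 2)" by (auto simp: eventually_sequentially)
  have "eventually (\<lambda>j. dist (x (r j)) xs < d / 2) sequentially"
    using tendstoD[OF r(2), of "d / 2"] d by (simp add: o_def)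
  then obtain J where J: "\<And>j. j \<ge> J \<Longrightarrow> dist (x (r j)) xs < d / 2" by (auto simp: eventually_sequentially)
  define k0 where "k0 = r (max J (max K K1))"
  have k0: "k0 \<ge> K" "k0 \<ge> K1" "dist (x k0) xs < d / 2"
    using seq_suble[OF r(1), of "max J (max K K1)"] J by (auto simp: k0_def)
  define S where "S n = (\<Sum>i<n. norm (x (Suc (k0 + i)) - x (k0 + i)))" for n
  have dist_S: "dist (x (k0 + n)) xs \<le> dist (x k0) xs + S n" for n
  proof (induction n)
    case (Suc n)
    then show ?case
      using dist_triangle[of "x (Suc (k0 + n))" xs "x (k0 + n)"] by (simp add: S_def dist_norm)
  qed (simp add: S_def)
  \<comment> \<open>The induction hypothesis bounds the length up to \<open>k0 + n\<close>, which
    keeps that iterate in the ball and so licenses the next application of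
    \<open>step\<close>.\<close>
  have main: "c * S n \<le> Phi k0 - Phi (k0 + n)" for n
  proof (induction n)
    case (Suc n)
    have "c * S n < c * (d / 2)"
      using Suc Phi(1)[of "k0 + n"] K1[OF k0(2)] k0(1) by simp
    then have "S n < d / 2" using c by simp
    then have "dist (x (k0 + n)) xs < d" using dist_S[of n] k0(3) by simp
    then have "c * norm (x (Suc (k0 + n)) - x (k0 + n)) \<le> Phi (k0 + n) - Phi (Suc (k0 + n))"
      using step[of "k0 + n"] k0(1) by simp
    then show ?case using Suc by (simp add: S_def algebra_simps)
  qed (simp add: S_def)
  have "S n \<le> Phi k0 / c" for n
  proof -
    have "c * S n \<le> Phi k0" using main[of n] Phi(1)[of "k0 + n"] k0(1) by simp
    then show ?thesis using c by (simp add: field_simps)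
  qed
  then have "summable (\<lambda>i. norm (x (Suc (k0 + i)) - x (k0 + i)))"
    unfolding S_def by (intro summableI_nonneg_bounded) auto
  then have "summable (\<lambda>i. norm (x (Suc (i + k0)) - x (i + k0)))" by (simp add: add.commute)
  then show sum: "summable (\<lambda>k. norm (x (Suc k) - x k))"
    by (subst (asm) summable_iff_shift[of "\<lambda>k. norm (x (Suc k) - x k)"])
  have "convergent (\<lambda>n. \<Sum>k<n. x (Suc k) - x k)"
    using summable_norm_cancel[OF sum] by (simp add: summable_iff_convergent)
  then have "convergent (\<lambda>n. x n - x 0)" by (simp add: sum_lessThan_telescope)
  then have "convergent x" by (simp add: convergent_diff_const_right_iff)
  then obtain z where z: "x \<longlonglongrightarrow> z" by (auto simp: convergent_def)
  have "z = xs" using LIMSEQ_unique[OF LIMSEQ_subseq_LIMSEQ[OF z r(1)] r(2)] .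
  then show "x \<longlonglongrightarrow> xs" using z by simp
qed

text \<open>A concave function lies below its tangents. The tangent is taken at the positive point
  \<open>a\<close>, interior to the domain, while \<open>b\<close> may be the endpoint 0, where
  \<open>Upsilon\<close> provides no derivative.\<close>

lemma Upsilon_tangent:
  assumes "Upsilon eta phi dphi" and b: "0 \<le> b" and a: "0 < a" "ereal a < eta" "ereal b < eta"
  shows "dphi a * (a - b) \<le> phi a - phi b"
proof -
  let ?I = "{t. 0 \<le> t \<and> ereal t < eta}"
  have conv: "convex_on ?I (\<lambda>t. - phi t)" and der: "(phi has_real_derivative dphi a) (at a)"
    using assms unfolding Upsilon_def concave_on_def by auto
  have "is_interval ?I"
    unfolding is_interval_1 by (auto intro: le_less_trans[of "ereal _" "ereal _"])
  then have "connected ?I" by (rule is_interval_connected)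
  moreover have "a \<in> interior ?I"
  proof (rule interiorI)
    have eq: "{0<..} \<inter> {t. ereal t < eta} = {0<..} \<inter> ereal -` {..<eta}" by auto
    have "open (ereal -` {..<eta})" by (intro open_vimage continuous_on_ereal) (auto intro: continuous_intros)
    then show "open ({0<..} \<inter> {t. ereal t < eta})" unfolding eq by (intro open_Int) auto
  qed (use a in auto)
  moreover have "((\<lambda>t. - phi t) has_real_derivative - dphi a) (at a within ?I)"
    by (rule DERIV_minus[OF has_field_derivative_at_within[OF der]])
  ultimately have "- dphi a * (b - a) \<le> - phi b - (- phi a)"
    using convex_on_imp_above_tangent[OF conv, of a b "- dphi a"] a b by simp
  then show ?thesis by (simp add: algebra_simps)
qed

section \<open>Runs of the algorithm\<close>

lemma infdist_less_obtain:
  fixes A :: "'a::metric_space set"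
  assumes "A \<noteq> {}" "infdist a A < d"
  obtains z where "z \<in> A" "dist a z < d"
proof -
  have "bdd_below ((\<lambda>z. dist a z) ` A)" by (intro bdd_belowI[of _ 0]) auto
  then have "\<exists>z\<in>A. dist a z < d"
    using assms by (simp add: infdist_notempty cINF_less_iff)
  then show thesis using that by blast
qed

lemma norm_transpose_mult_le:
  fixes M :: "real^'n^'n"
  assumes "\<And>v. norm (M *v v) \<le> C * norm v"
  shows "norm (transpose M *v v) \<le> C * norm v"
proof -
  let ?w = "transpose M *v v"
  have "norm ?w * norm ?w = inner (M *v ?w) v"
    using inner_matrix_transpose[of M ?w v] by (simp add: power2_norm_eq_inner[symmetric] power2_eq_square)
  also have "\<dots> \<le> norm (M *v ?w) * norm v" by (rule norm_cauchy_schwarz)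
  also have "\<dots> \<le> C * norm ?w * norm v" by (intro mult_right_mono assms) simp
  finally have "norm ?w * norm ?w \<le> norm ?w * (C * norm v)" by (simp add: mult_ac)
  moreover have "0 \<le> C * norm v" using assms[of v] norm_ge_zero order_trans by blast
  ultimately show ?thesis by (cases "norm ?w = 0") (auto simp: mult_le_cancel_left)
qed

text \<open>The matrix need not be symmetric, so its symmetric part enters the gradient of the model.\<close>
lemma Theta_subdiff_normal:
  fixes G :: "real^'n^'n"
  assumes P: "convex P" "closed P" and v: "v \<in> limiting_subdiff (Theta f df P G x) y"
    and G: "\<And>h. norm (G *v h) \<le> C * norm h"
  obtains w where "v - df x - w \<in> normal_cone P y" "norm w \<le> C * norm (y - x)"
    "inner w (y - x) = inner (y - x) (G *v (y - x))"
proof -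
  define q where "q z = f x + inner (df x) (z - x) + 1/2 * inner (z - x) (G *v (z - x))" for z
  define w where "w z = (1/2) *\<^sub>R (G *v (z - x) + transpose G *v (z - x))" for z
  have lin: "((\<lambda>z. M *v (z - x)) has_derivative (\<lambda>h. M *v h)) (at z)" for z and M :: "real^'n^'n"
    by (rule bounded_linear.has_derivative[OF matrix_vector_mul_bounded_linear])
       (auto intro!: derivative_eq_intros)
  have id: "((\<lambda>z. z - x) has_derivative (\<lambda>h. h)) (at z)" for z
    by (auto intro!: derivative_eq_intros)
  have "(q has_derivative (\<lambda>h. inner (df x + w z) h)) (at z)" for z
  proof -
    have "(q has_derivative (\<lambda>h. 0 + inner (df x) h +
        1/2 * (inner (z - x) (G *v h) + inner h (G *v (z - x))))) (at z)"
      unfolding q_def[abs_def]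
      by (intro has_derivative_add has_derivative_const has_derivative_inner_right id
          has_derivative_mult_right has_derivative_inner lin)
    moreover have "0 + inner (df x) h + 1/2 * (inner (z - x) (G *v h) + inner h (G *v (z - x)))
        = inner (df x + w z) h" for h
      using inner_matrix_transpose[of G h "z - x"]
      by (simp add: w_def inner_add_left inner_add_right inner_commute)
    ultimately show ?thesis by simp
  qed
  moreover have "continuous_on UNIV (\<lambda>z. df x + w z)"
    unfolding w_def
    by (intro continuous_intros has_derivative_continuous_on[OF has_derivative_at_withinI[OF lin]])
  moreover have "Theta f df P G x = (\<lambda>z. if z \<in> P then ereal (q z) else \<infinity>)"
    by (auto simp: Theta_def q_def)
  ultimately have N: "v - (df x + w y) \<in> normal_cone P y"
    using limiting_subdiff_restrict[OF P, of q "\<lambda>z. df x + w z" v y] v by simp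
  have nw: "norm (w y) \<le> C * norm (y - x)"
    using norm_triangle_ineq[of "G *v (y - x)" "transpose G *v (y - x)"]
      G[of "y - x"] norm_transpose_mult_le[OF G, of "y - x"] by (simp add: w_def)
  have "inner (w y) (y - x) = inner (y - x) (G *v (y - x))"
    using inner_matrix_transpose[of G "y - x" "y - x"]
    by (simp add: w_def inner_add_left inner_add_right inner_commute)
  then show thesis using that[of "w y"] N nw by (simp add: diff_diff_eq)
qed

lemma PGiPN_runD:
  assumes run: "PGiPN_run f df Hf B lam1 lam2 l u A b hh dh ddh
                mumin mumax tau alpha b1 b2 rho sgm vsig beta x mu m xbar G y t"
  shows "x 0 \<in> box_set l u" and "mumin \<le> mu k" and "mu k \<le> mumax"
    and "PG_accept f df B lam1 lam2 l u alpha (mu k * tau ^ m k) (x k) (xbar k)"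
    and "m' < m k \<Longrightarrow> \<not> PG_accept f df B lam1 lam2 l u alpha (mu k * tau ^ m') (x k) z"
    and "\<not> (supp (x k) = supp (xbar k) \<and> supp (B *v x k) = supp (B *v xbar k)) \<Longrightarrow> x (Suc k) = xbar k"
  using run[unfolded PGiPN_run_def Let_def] by (auto split: if_splits)

lemma PGiPN_run_newton:
  assumes run: "PGiPN_run f df Hf B lam1 lam2 l u A b hh dh ddh
                mumin mumax tau alpha b1 b2 rho sgm vsig beta x mu m xbar G y t"
    and s: "supp (x k) = supp (xbar k)" "supp (B *v x k) = supp (B *v xbar k)"
    and r: "r = norm ((mu k * tau ^ m k) *\<^sub>R (x k - xbar k))"
  shows "G_admissible f Hf A b hh dh ddh b2 (b1 * r powr sgm) (x k) (G k)"
    and "Theta f df (Pi_set B l u (x k)) (G k) (x k) (y k)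
           \<le> Theta f df (Pi_set B l u (x k)) (G k) (x k) (x k)"
    and "limiting_subdiff (Theta f df (Pi_set B l u (x k)) (G k) (x k)) (y k) \<noteq> {}"
    and "infdist 0 (limiting_subdiff (Theta f df (Pi_set B l u (x k)) (G k) (x k)) (y k))
           \<le> min (1 / (mu k * tau ^ m k)) 1 / 2 * min r (r powr (1 + vsig))"
    and "f (x k + beta ^ t k *\<^sub>R (y k - x k))
           \<le> f (x k) + rho * beta ^ t k * inner (df (x k)) (y k - x k)"
    and "t' < t k \<Longrightarrow> \<not> f (x k + beta ^ t' *\<^sub>R (y k - x k))
           \<le> f (x k) + rho * beta ^ t' * inner (df (x k)) (y k - x k)"
    and "x (Suc k) = x k + beta ^ t k *\<^sub>R (y k - x k)"
proof -
  note R = conjunct2[OF run[unfolded PGiPN_run_def Let_def], rule_format, of k, folded r]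
  have "supp (x k) = supp (xbar k) \<and> supp (B *v x k) = supp (B *v xbar k)" using s by simp
  note R = R[unfolded if_P[OF this]]
  show "G_admissible f Hf A b hh dh ddh b2 (b1 * r powr sgm) (x k) (G k)"
    and "Theta f df (Pi_set B l u (x k)) (G k) (x k) (y k)
           \<le> Theta f df (Pi_set B l u (x k)) (G k) (x k) (x k)"
    and "limiting_subdiff (Theta f df (Pi_set B l u (x k)) (G k) (x k)) (y k) \<noteq> {}"
    and "infdist 0 (limiting_subdiff (Theta f df (Pi_set B l u (x k)) (G k) (x k)) (y k))
           \<le> min (1 / (mu k * tau ^ m k)) 1 / 2 * min r (r powr (1 + vsig))"
    and "f (x k + beta ^ t k *\<^sub>R (y k - x k))
           \<le> f (x k) + rho * beta ^ t k * inner (df (x k)) (y k - x k)"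
    and "t' < t k \<Longrightarrow> \<not> f (x k + beta ^ t' *\<^sub>R (y k - x k))
           \<le> f (x k) + rho * beta ^ t' * inner (df (x k)) (y k - x k)"
    and "x (Suc k) = x k + beta ^ t k *\<^sub>R (y k - x k)"
    using R by blast+
qed

lemma Theta_le_start:
  assumes "Theta f df P G x y \<le> Theta f df P G x x" "x \<in> P"
  shows "y \<in> P" and "inner (df x) (y - x) \<le> - (1/2) * inner (y - x) (G *v (y - x))"
  using assms by (auto simp: Theta_def split: if_splits)

text \<open>A Newton update is a convex combination of \<open>x k\<close> and \<open>y k\<close>,
  and the comparison of the values of \<open>Theta\<close> forces \<open>y k\<close> into
  \<open>Pi_set\<close>, hence into the box.\<close>

lemma PGiPN_run_box:
  assumes run: "PGiPN_run f df Hf B lam1 lam2 l u A b hh dh ddh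
                mumin mumax tau alpha b1 b2 rho sgm vsig beta x mu m xbar G y t"
    and beta: "0 \<le> beta" "beta \<le> 1"
  shows "x k \<in> box_set l u" and "xbar k \<in> box_set l u"
proof -
  show xbar: "xbar k \<in> box_set l u" for k
    using PGiPN_runD(4)[OF run, of k] by (simp add: PG_accept_def prox_set_def)
  show "x k \<in> box_set l u"
  proof (induction k)
    case 0
    show ?case by (rule PGiPN_runD(1)[OF run])
  next
    case (Suc k)
    show ?case
    proof (cases "supp (x k) = supp (xbar k) \<and> supp (B *v x k) = supp (B *v xbar k)")
      case True
      note N = PGiPN_run_newton[OF run conjunct1[OF True] conjunct2[OF True] refl]
      have "x k \<in> Pi_set B l u (x k)" using Suc by (simp add: Pi_set_def)
      from Theta_le_start(1)[OF N(2) this] have "y k \<in> box_set l u" by (simp add: Pi_set_def)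
      then have "(1 - beta ^ t k) *\<^sub>R x k + beta ^ t k *\<^sub>R y k \<in> box_set l u"
        using Suc beta unfolding box_set_cbox
        by (intro convexD_alt[OF convex_box(1)]) (auto simp: power_le_one)
      then show ?thesis by (simp add: N(7) algebra_simps)
    next
      case False
      then show ?thesis using PGiPN_runD(6)[OF run False] xbar by simp
    qed
  qed
qed

theorem theorem5p5:
  fixes f :: "real^'n \<Rightarrow> real" and df :: "real^'n \<Rightarrow> real^'n" and Hf :: "real^'n \<Rightarrow> real^'n^'n"
    and B :: "real^'n^'p" and lam1 lam2 :: real and l u :: "real^'n"
    and A :: "real^'n^'m" and b :: "real^'m" and hh dh ddh :: "'m \<Rightarrow> real \<Rightarrow> real"
    and mumin mumax tau alpha b1 b2 rho sgm vsig beta :: real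
    and x xbar y :: "nat \<Rightarrow> real^'n" and mu :: "nat \<Rightarrow> real" and m t :: "nat \<Rightarrow> nat"
    and G :: "nat \<Rightarrow> real^'n^'n"
    and Pstar :: "(real^'n) set"
    and xi :: "nat \<Rightarrow> real^'n"
  assumes f_grad: "\<And>z. (f has_derivative (\<lambda>h. inner (df z) h)) (at z)"
    and f_hess: "\<And>z. (df has_derivative (\<lambda>h. Hf z *v h)) (at z)"
    and Hf_cont: "continuous_on UNIV Hf"
    and lam: "lam1 > 0" "lam2 > 0"
    and lu: "\<And>i. l $ i \<le> 0" "\<And>i. 0 \<le> u $ i"
    and par: "mumax > mumin" "mumin > 0" "tau > 1" "alpha > 0" "b1 > 0" "b2 \<ge> 1"
      "0 < rho" "rho < 1/2" "0 < sgm" "sgm < 1/2" "sgm < vsig" "vsig \<le> 1"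
      "0 < beta" "beta < 1"
    and run: "PGiPN_run f df Hf B lam1 lam2 l u A b hh dh ddh
                mumin mumax tau alpha b1 b2 rho sgm vsig beta x mu m xbar G y t"
    and nostop: "\<And>k. x k \<noteq> xbar k"
    and Pstar: "eventually (\<lambda>k. Pi_set B l u (x k) = Pstar) sequentially"
    and A1: "\<exists>U. open U \<and> acc_points x \<subseteq> U \<and>
               (\<forall>z\<in>U. \<exists>d>0. \<exists>L. L-lipschitz_on (ball z d \<inter> U) Hf)"
    and A2: "\<And>xs. xs \<in> acc_points x \<Longrightarrow>
               0 \<in> (\<lambda>v. df xs + v) ` rel_interior (normal_cone Pstar xs)"
    and A3: "eventually (\<lambda>k. xi k \<in> normal_cone Pstar (x k)) sequentially \<and>
             liminf (\<lambda>k. ereal (- inner (df (x k) + xi k) (y k - x k)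
                     / (norm (df (x k) + xi k) * norm (y k - x k)))) > 0"
    and KL: "KL_function (\<lambda>z. if z \<in> Pstar then ereal (f z) else \<infinity>)"
  shows "summable (\<lambda>k. norm (x (Suc k) - x k)) \<and>
         (\<exists>xs. x \<longlonglongrightarrow> xs \<and> L_stationary df B lam1 lam2 l u xs)"
proof -

  \<comment> \<open>Step parameters and positivity of the residual\<close>
  let ?S = "box_set l u"
  have S: "compact ?S" "convex ?S" by (simp_all add: box_set_cbox convex_box(1))
  define mb where "mb k = mu k * tau ^ m k" for k
  define r where "r k = norm (mb k *\<^sub>R (x k - xbar k))" for k
  define d where "d k = y k - x k" for k
  define e where "e k = b1 * r k powr sgm" for k
  have xS: "x k \<in> ?S" and xbS: "xbar k \<in> ?S" for k
    using PGiPN_run_box[OF run] par by auto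
  have mb_min: "mumin \<le> mb k" for k
  proof -
    have "mumin * 1 \<le> mu k * tau ^ m k"
      using PGiPN_runD(2)[OF run, of k] par by (intro mult_mono) auto
    then show ?thesis by (simp add: mb_def)
  qed
  have mb_pos: "0 < mb k" for k using mb_min[of k] par(2) by linarith
  have r_pos: "0 < r k" for k using mb_pos[of k] nostop[of k] by (simp add: r_def)
  have prox: "xbar k \<in> prox_set B lam1 lam2 l u (1 / mb k) (x k - (1 / mb k) *\<^sub>R df (x k))" for k
    using PGiPN_runD(4)[OF run, of k] by (simp add: PG_accept_def mb_def)

  \<comment> \<open>Uniform bounds on the compact box\<close>
  obtain L0 where L0: "L0 \<ge> 0" "\<And>z h. z \<in> ?S \<Longrightarrow> norm (Hf z *v h) \<le> L0 * norm h"
    using compact_matrix_bound[OF S(1) continuous_on_subset[OF Hf_cont]] by (metis subset_UNIV)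
  \<comment> \<open>The added 1 makes the constant strictly positive, as the line search bound
    divides by it.\<close>
  define L where "L = L0 + 1"
  have L: "L > 0" using L0(1) by (simp add: L_def)
  have LH: "norm (Hf z *v h) \<le> L * norm h" if "z \<in> ?S" for z h
    using order_trans[OF L0(2)[OF that, of h], of "L * norm h"] by (simp add: L_def distrib_right)
  have est: "f z \<le> f w + inner (df w) (z - w) + L * (norm (z - w))\<^sup>2" if "w \<in> ?S" "z \<in> ?S" for w z
    using descent_estimate[OF f_grad f_hess S(2) that LH] by blast
  have cont_df: "continuous_on UNIV df"
    using has_derivative_continuous_on[OF has_derivative_at_withinI[OF f_hess]] by blast
  have cont_f: "continuous_on UNIV f"
    using has_derivative_continuous_on[OF has_derivative_at_withinI[OF f_grad]] by blast

  \<comment> \<open>Without backtracking \<open>mb k\<close> is \<open>mu k\<close>; otherwise the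
    preceding trial was rejected, so it lies below \<open>2 * L + alpha\<close>, and one factor
    \<open>tau\<close> is lost.\<close>
  define M where "M = max mumax (tau * (2 * L + alpha))"
  have mb_max: "mb k \<le> M" for k
  proof (cases "m k")
    case 0
    then show ?thesis using PGiPN_runD(3)[OF run, of k] by (simp add: mb_def M_def)
  next
    case (Suc j)
    have c: "mu k * tau ^ j > 0" using PGiPN_runD(2)[OF run, of k] par by simp
    have "\<not> 2 * L + alpha \<le> mu k * tau ^ j"
    proof
      assume big: "2 * L + alpha \<le> mu k * tau ^ j"
      have "\<exists>z. PG_accept f df B lam1 lam2 l u alpha (mu k * tau ^ j) (x k) z"
        by (rule PG_accept_large[where L = L]) (use lu lam xS c big est[OF xS] in auto)
      then show False using PGiPN_runD(5)[OF run, of j k] Suc by auto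
    qed
    then have "tau * (mu k * tau ^ j) \<le> tau * (2 * L + alpha)" using par by simp
    then show ?thesis by (simp add: mb_def Suc M_def mult_ac)
  qed
  have M: "M > 0" using mb_max[of 0] mb_pos[of 0] by linarith
  obtain D0 where D0: "D0 > 0" "\<And>z. z \<in> ?S \<Longrightarrow> norm z \<le> D0"
    using compact_imp_bounded[OF S(1)] unfolding bounded_pos by blast
  have diam: "norm (z - w) \<le> 2 * D0" if "z \<in> ?S" "w \<in> ?S" for z w
    using norm_triangle_ineq4[of z w] D0(2)[OF that(1)] D0(2)[OF that(2)] by linarith
  define R where "R = M * (2 * D0)"
  have r_max: "r k \<le> R" for k
    unfolding r_def R_def using mb_pos[of k] mb_max[of k] diam[OF xS xbS, of k k] M
    by (simp add: mult_mono)
  have e_pos: "0 < e k" for k using r_pos[of k] par by (simp add: e_def)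
  have e_max: "e k \<le> b1 * R powr sgm" for k
    unfolding e_def using r_pos[of k] r_max[of k] par by (intro mult_left_mono powr_mono2) auto
  obtain \<Gamma> where Gam: "\<Gamma> \<ge> 0" and "\<And>z c H v. z \<in> ?S \<Longrightarrow> 0 \<le> c \<Longrightarrow> c \<le> b1 * R powr sgm \<Longrightarrow>
      G_admissible f Hf A b hh dh ddh b2 c z H \<Longrightarrow> norm (H *v v) \<le> \<Gamma> * norm v"
    using G_admissible_bound[OF f_grad f_hess Hf_cont par(6) S(1)] by metis
  then have GamG: "norm (G k *v v) \<le> \<Gamma> * norm v"
    if "G_admissible f Hf A b hh dh ddh b2 (e k) (x k) (G k)" for k v
    using that xS e_pos[of k] e_max[of k] less_imp_le by blast

  \<comment> \<open>Frozen supports and Newton steps\<close>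
  obtain k0 where k0: "\<And>k. k \<ge> k0 \<Longrightarrow> Pi_set B l u (x k) = Pstar"
    using Pstar by (auto simp: eventually_sequentially)
  have xP: "x k \<in> Pstar" if "k \<ge> k0" for k
    using k0[OF that] xS[of k] by (auto simp: Pi_set_def)
  have supp_const: "supp (x k) = supp (x j) \<and> supp (B *v x k) = supp (B *v x j)"
    if "k \<ge> k0" "j \<ge> k0" for k j
    using xP[OF that(1)] xP[OF that(2)] k0[OF that(1)] k0[OF that(2)] by (auto simp: Pi_set_def)
  have supp_eq: "supp (x k) = supp (xbar k) \<and> supp (B *v x k) = supp (B *v xbar k)" if "k \<ge> k0" for k
  proof (rule ccontr)
    \<comment> \<open>Such a step would set the next iterate to \<open>xbar k\<close>; constancy of
      the supports along the iterates would then make the support test succeed.\<close>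
    assume ne: "\<not> ?thesis"
    from PGiPN_runD(6)[OF run ne] show False using supp_const[OF that, of "Suc k"] that ne by simp
  qed
  note newton = PGiPN_run_newton[OF run conjunct1[OF supp_eq] conjunct2[OF supp_eq] r_def[unfolded mb_def]]
  have cP: "convex Pstar" "closed Pstar"
    using convex_Pi_set[of B l u "x k0"] compact_imp_closed[OF compact_Pi_set[of B l u "x k0"]] k0[of k0]
    by auto
  have PS: "Pstar \<subseteq> ?S" using k0[of k0] by (auto simp: Pi_set_def)
  have G_adm: "G_admissible f Hf A b hh dh ddh b2 (e k) (x k) (G k)" if "k \<ge> k0" for k
    using newton(1)[OF that that] by (simp add: e_def)
  have yP: "y k \<in> Pstar" and desc: "inner (df (x k)) (d k) \<le> - (1/2) * inner (d k) (G k *v d k)"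
    if "k \<ge> k0" for k
    using Theta_le_start[OF newton(2)[OF that that]] xP[OF that] k0[OF that] by (auto simp: d_def)
  have G_low: "e k * (norm (d k))\<^sup>2 \<le> inner (d k) (G k *v d k)" if "k \<ge> k0" for k
    using G_admissible_lower[OF f_grad f_hess Hf_cont par(6) G_adm[OF that]] .

  \<comment> \<open>Normals of the polytope at the Newton and proximal points\<close>
  have "\<forall>k. k \<ge> k0 \<longrightarrow> (\<exists>v w. v - df (x k) - w \<in> normal_cone Pstar (y k) \<and> norm v \<le> 3/4 * r k \<and>
      norm w \<le> \<Gamma> * norm (d k) \<and> inner w (d k) = inner (d k) (G k *v d k))"
  proof (intro allI impI)
    fix k assume k: "k \<ge> k0"
    let ?D = "limiting_subdiff (Theta f df Pstar (G k) (x k)) (y k)"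
    have ne: "?D \<noteq> {}" using newton(3)[OF k k] k0[OF k] by simp
    \<comment> \<open>The criterion bounds only an infimum, by \<open>r k / 2\<close>; the larger
      factor \<open>3/4\<close> gives the strict inequality that lets an actual subgradient be
      chosen.\<close>
    have "min (1 / mb k) 1 / 2 * min (r k) (r k powr (1 + vsig)) \<le> 1 / 2 * r k"
      using r_pos[of k] mb_pos[of k] by (intro mult_mono) auto
    also have "\<dots> < 3/4 * r k" using r_pos[of k] by simp
    finally have "infdist 0 ?D < 3/4 * r k"
      using order_le_less_trans[OF newton(4)[OF k k, folded mb_def, unfolded k0[OF k]]] by blast
    then obtain v where v: "v \<in> ?D" "norm v \<le> 3/4 * r k"
      using infdist_less_obtain[OF ne] by (metis dist_0_norm less_imp_le)
    obtain w where "v - df (x k) - w \<in> normal_cone Pstar (y k)" "norm w \<le> \<Gamma> * norm (d k)"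
      "inner w (d k) = inner (d k) (G k *v d k)"
      using Theta_subdiff_normal[OF cP v(1) GamG[OF G_adm[OF k]]] unfolding d_def by blast
    then show "\<exists>v w. v - df (x k) - w \<in> normal_cone Pstar (y k) \<and> norm v \<le> 3/4 * r k \<and>
      norm w \<le> \<Gamma> * norm (d k) \<and> inner w (d k) = inner (d k) (G k *v d k)" using v(2) by blast
  qed
  then obtain v w where vw: "\<And>k. k \<ge> k0 \<Longrightarrow> v k - df (x k) - w k \<in> normal_cone Pstar (y k)"
    "\<And>k. k \<ge> k0 \<Longrightarrow> norm (v k) \<le> 3/4 * r k" "\<And>k. k \<ge> k0 \<Longrightarrow> norm (w k) \<le> \<Gamma> * norm (d k)"
    "\<And>k. k \<ge> k0 \<Longrightarrow> inner (w k) (d k) = inner (d k) (G k *v d k)"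
    by metis
  have xbN: "mb k *\<^sub>R (x k - xbar k) - df (x k) \<in> normal_cone Pstar (xbar k)" if "k \<ge> k0" for k
  proof -
    have "Pi_set B l u (xbar k) = Pstar" using supp_eq[OF that] k0[OF that] by (simp add: Pi_set_def)
    then show ?thesis
      using prox_set_normal[OF prox mb_pos less_imp_le[OF lam(1)] less_imp_le[OF lam(2)], of k] by simp
  qed

  \<comment> \<open>Residual against Newton direction\<close>
  define a where "a = 5 * (7/4 * M + \<Gamma>)"
  have a: "a > 0" using M Gam by (simp add: a_def)
  have r_le: "r k \<le> a * norm (d k)"
    and wd_le: "inner (w k) (d k) \<le> r k * ((7/4 + \<Gamma> / mumin) * norm (d k) + r k / mumin)"
    if "k \<ge> k0" for k
    using step_estimates[OF vw(1)[OF that] xbN[OF that] r_def vw(2)[OF that] par(2) mb_min mb_max Gam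
        vw(3)[OF that, unfolded d_def]]
    by (auto simp: a_def d_def)
  have d_ne: "d k \<noteq> 0" if "k \<ge> k0" for k using r_le[OF that] r_pos[of k] by auto

  \<comment> \<open>Step lengths and Armijo decrease\<close>
  define c1 where "c1 = beta * (1 - rho) / (2 * L)"
  have c1: "c1 > 0" using par L by (simp add: c1_def)
  define al where "al k = beta ^ t k" for k
  have al: "0 < al k" "al k \<le> 1" for k using par by (auto simp: al_def power_le_one)
  have step: "x (Suc k) - x k = al k *\<^sub>R d k" if "k \<ge> k0" for k
    using newton(7)[OF that that] by (simp add: d_def al_def)
  have desc_e: "inner (df (x k)) (d k) \<le> - (e k / 2) * (norm (d k))\<^sup>2" if "k \<ge> k0" for k
    using desc[OF that] G_low[OF that] by simp
  have al_low: "min 1 (c1 * e k) \<le> al k" if k: "k \<ge> k0" for k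
  proof -
    have "f (x k + s *\<^sub>R d k) \<le> f (x k) + s * inner (df (x k)) (d k) + L * s\<^sup>2 * (norm (d k))\<^sup>2"
      if s: "0 \<le> s" "s \<le> 1" for s
    proof -
      have "(1 - s) *\<^sub>R x k + s *\<^sub>R y k \<in> ?S"
        using convexD_alt[OF S(2) xS _ s] yP[OF k] PS by blast
      then have "x k + s *\<^sub>R d k \<in> ?S" by (simp add: d_def algebra_simps)
      from est[OF xS[of k] this] show ?thesis by (simp add: power_mult_distrib mult.assoc)
    qed
    from line_search_lower[OF d_ne[OF k] L par(13,14) _ desc_e[OF k] this, of rho "t k"]
    have "min 1 (beta * (1 - rho) * e k / (2 * L)) \<le> beta ^ t k"
      using newton(6)[OF k k] par by (auto simp: d_def)
    then show ?thesis by (simp add: al_def c1_def)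
  qed
  have f_dec: "rho * al k * (- inner (df (x k)) (d k)) \<le> f (x k) - f (x (Suc k))" if "k \<ge> k0" for k
    using newton(5)[OF that that] newton(7)[OF that that] by (simp add: d_def al_def)
  \<comment> \<open>The decrease of \<open>f\<close> guaranteed by a residual of size
    \<open>s\<close> alone: lower bound for the step length times lower bound for the descent, with
    \<open>norm (d k)\<close> replaced by \<open>r k / a\<close>. By monotonicity, residuals above
    some level force a fixed decrease.\<close>
  define psi where "psi s = rho * min 1 (c1 * (b1 * s powr sgm)) * (b1 * s powr sgm / 2 * (s / a)\<^sup>2)" for s
  have psi_mono: "psi s \<le> psi s'" if "0 \<le> s" "s \<le> s'" for s s'
    unfolding psi_def using that par a c1
    by (intro mult_mono min.mono divide_right_mono powr_mono2 power_mono order_refl) auto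
  have psi_le: "psi (r k) \<le> f (x k) - f (x (Suc k))" if k: "k \<ge> k0" for k
  proof -
    have "(r k / a) \<le> norm (d k)" using r_le[OF k] a by (simp add: field_simps)
    then have "(r k / a)\<^sup>2 \<le> (norm (d k))\<^sup>2" using r_pos[of k] a by (intro power_mono) auto
    then have "e k / 2 * (r k / a)\<^sup>2 \<le> e k / 2 * (norm (d k))\<^sup>2"
      using e_pos[of k] by (intro mult_left_mono) auto
    also have "\<dots> \<le> - inner (df (x k)) (d k)" using desc_e[OF k] by simp
    finally have "rho * min 1 (c1 * e k) * (e k / 2 * (r k / a)\<^sup>2) \<le> rho * al k * (- inner (df (x k)) (d k))"
      using al_low[OF k] al[of k] par e_pos[of k] c1 by (intro mult_mono) auto
    then show ?thesis using f_dec[OF k] by (simp add: psi_def e_def)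
  qed
  have f_strict: "f (x (Suc k)) < f (x k)" if "k \<ge> k0" for k
  proof -
    have "0 < e k / 2 * (norm (d k))\<^sup>2" using e_pos[of k] d_ne[OF that] by simp
    then have "0 < - inner (df (x k)) (d k)" using desc_e[OF that] by linarith
    then have "0 < rho * al k * (- inner (df (x k)) (d k))" using al[of k] par by (intro mult_pos_pos) auto
    then show ?thesis using f_dec[OF that] by linarith
  qed

  \<comment> \<open>Convergence of the values, vanishing residuals and directions\<close>
  obtain fs where fs: "(\<lambda>k. f (x k)) \<longlonglongrightarrow> fs" "\<And>k. k \<ge> k0 \<Longrightarrow> fs \<le> f (x k)"
  proof -
    obtain z where z: "\<forall>w\<in>?S. f z \<le> f w"
      using continuous_attains_inf[OF S(1) _ continuous_on_subset[OF cont_f]] xS by blast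
    have "decseq (\<lambda>i. f (x (i + k0)))"
      unfolding decseq_Suc_iff using less_imp_le[OF f_strict] by simp
    then obtain c where c: "(\<lambda>i. f (x (i + k0))) \<longlonglongrightarrow> c" "\<forall>i. c \<le> f (x (i + k0))"
      using decseq_convergent[of "\<lambda>i. f (x (i + k0))" "f z"] z xS by metis
    show thesis
    proof (rule that)
      show "(\<lambda>k. f (x k)) \<longlonglongrightarrow> c" by (rule LIMSEQ_offset[OF c(1)])
      show "c \<le> f (x k)" if "k \<ge> k0" for k using c(2)[rule_format, of "k - k0"] that by simp
    qed
  qed
  have r_lim: "r \<longlonglongrightarrow> 0"
  proof (rule LIMSEQ_I)
    fix \<epsilon> :: real assume eps: "\<epsilon> > 0"
    have "psi \<epsilon> > 0" unfolding psi_def using eps par c1 a by (intro mult_pos_pos) auto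
    moreover have "(\<lambda>k. f (x k) - f (x (Suc k))) \<longlonglongrightarrow> fs - fs"
      by (intro tendsto_diff fs(1) LIMSEQ_Suc[OF fs(1)])
    ultimately have "eventually (\<lambda>k. f (x k) - f (x (Suc k)) < psi \<epsilon>) sequentially"
      using order_tendstoD(2) by fastforce
    then obtain K where K: "\<And>k. k \<ge> K \<Longrightarrow> f (x k) - f (x (Suc k)) < psi \<epsilon>"
      by (auto simp: eventually_sequentially)
    have "norm (r k - 0) < \<epsilon>" if "k \<ge> max K k0" for k
    proof (rule ccontr)
      assume "\<not> norm (r k - 0) < \<epsilon>"
      then have "\<epsilon> \<le> r k" using r_pos[of k] by simp
      then have "psi \<epsilon> \<le> psi (r k)" using eps by (intro psi_mono) auto
      then show False using psi_le[of k] K[of k] that by simp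
    qed
    then show "\<exists>no. \<forall>n\<ge>no. norm (r n - 0) < \<epsilon>" by blast
  qed
  have d_lim: "(\<lambda>k. norm (d k)) \<longlonglongrightarrow> 0"
  proof -
    \<comment> \<open>Dividing the curvature estimate by \<open>e k = b1 * r k powr sgm\<close>
      leaves the positive power \<open>1 - sgm\<close> of the residual, which tends to 0.\<close>
    define C where "C = ((7/4 + \<Gamma> / mumin) * (2 * D0) + R / mumin) / b1"
    have "(norm (d k))\<^sup>2 \<le> C * r k powr (1 - sgm)" if k: "k \<ge> k0" for k
    proof -
      have "norm (d k) \<le> 2 * D0" unfolding d_def using yP[OF k] PS xS by (intro diam) auto
      then have "(7/4 + \<Gamma> / mumin) * norm (d k) + r k / mumin \<le> C * b1"
        unfolding C_def using par Gam r_max[of k]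
        by (simp, intro add_mono mult_left_mono divide_right_mono) auto
      then have "r k * ((7/4 + \<Gamma> / mumin) * norm (d k) + r k / mumin) \<le> r k * (C * b1)"
        using r_pos[of k] by (intro mult_left_mono) auto
      then have "e k * (norm (d k))\<^sup>2 \<le> r k * (C * b1)"
        using wd_le[OF k] G_low[OF k] vw(4)[OF k] by linarith
      also have "r k = r k powr sgm * r k powr (1 - sgm)"
        using r_pos[of k] by (simp flip: powr_add)
      finally have "(b1 * r k powr sgm) * (norm (d k))\<^sup>2 \<le> (b1 * r k powr sgm) * (C * r k powr (1 - sgm))"
        by (simp add: e_def mult_ac)
      then show ?thesis using e_pos[of k] unfolding e_def by (rule mult_left_le_imp_le)
    qed
    then have bound: "eventually (\<lambda>k. norm ((norm (d k))\<^sup>2) \<le> C * r k powr (1 - sgm)) sequentially"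
      by (intro eventually_sequentiallyI[of k0]) simp
    have "eventually (\<lambda>k. 0 \<le> r k) sequentially" by (rule always_eventually) (simp add: r_def)
    from tendsto_mult_right_zero[OF tendsto_zero_powrI[OF r_lim tendsto_const this, of "1 - sgm"], of C] par
    have "(\<lambda>k. C * r k powr (1 - sgm)) \<longlonglongrightarrow> 0" by simp
    with bound have "(\<lambda>k. (norm (d k))\<^sup>2) \<longlonglongrightarrow> 0" by (rule Lim_null_comparison)
    from tendsto_real_sqrt[OF this] show ?thesis by simp
  qed

  \<comment> \<open>The accumulation point and its neighbourhoods\<close>
  obtain xs where acc: "xs \<in> acc_points x"
    using S(1) xS unfolding compact_def acc_points_def by blast
  then obtain q where q: "strict_mono q" "(x \<circ> q) \<longlonglongrightarrow> xs" by (auto simp: acc_points_def)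
  have xsP: "xs \<in> Pstar"
  proof (rule closed_sequentially[OF cP(2)])
    show "(\<lambda>i. (x \<circ> q) (i + k0)) \<longlonglongrightarrow> xs" by (rule LIMSEQ_ignore_initial_segment[OF q(2)])
    show "(x \<circ> q) (i + k0) \<in> Pstar" for i
      using xP[of "q (i + k0)"] seq_suble[OF q(1), of "i + k0"] by simp
  qed
  have fxs: "f xs = fs"
  proof (rule LIMSEQ_unique)
    show "(\<lambda>i. f ((x \<circ> q) i)) \<longlonglongrightarrow> f xs"
      using continuous_on_tendsto_compose[OF cont_f q(2)] by simp
    show "(\<lambda>i. f ((x \<circ> q) i)) \<longlonglongrightarrow> fs"
      using LIMSEQ_subseq_LIMSEQ[OF fs(1) q(1)] by (simp add: o_def)
  qed
  let ?h = "\<lambda>z. if z \<in> Pstar then ereal (f z) else \<infinity>"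
  have sub: "g \<in> limiting_subdiff ?h z \<longleftrightarrow> g - df z \<in> normal_cone Pstar z" for g z
    by (rule limiting_subdiff_restrict[OF cP f_grad cont_df])
  \<comment> \<open>The zero vector is normal to \<open>Pstar\<close> at \<open>xs\<close>, so
    \<open>xs\<close> lies in the domain of the subdifferential.\<close>
  have "df xs \<in> limiting_subdiff ?h xs" using xsP by (auto simp: sub intro: normal_coneI)
  then have "KL_at ?h xs" using KL unfolding KL_function_def by blast
  then obtain eta U phi dphi where kl: "eta > 0" "open U" "xs \<in> U" "Upsilon eta phi dphi"
    "\<And>z. z \<in> U \<Longrightarrow> ?h xs < ?h z \<Longrightarrow> ?h z < ?h xs + eta \<Longrightarrow> limiting_subdiff ?h z \<noteq> {} \<Longrightarrow>
        dphi (real_of_ereal (?h z - ?h xs)) * infdist 0 (limiting_subdiff ?h z) \<ge> 1"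
    unfolding KL_at_def by blast
  obtain dU where dU: "dU > 0" "ball xs dU \<subseteq> U" using kl(2,3) openE by blast
  have "- df xs \<in> rel_interior (normal_cone Pstar xs)"
    using A2[OF acc] by (auto simp: add_eq_0_iff)
  then obtain dI where dI: "dI > 0" "\<And>z \<omega> \<nu>. z \<in> Pstar \<Longrightarrow> 2 *\<^sub>R z - xs \<in> Pstar \<Longrightarrow>
      \<omega> \<in> normal_cone Pstar z \<Longrightarrow> norm (\<omega> - - df xs) < dI \<Longrightarrow>
      \<nu> \<in> normal_cone Pstar xs \<Longrightarrow> inner \<nu> (z - xs) = 0"
    using face_identification[OF xsP] by metis
  obtain dL where dL: "dL > 0" "\<And>z. z \<in> Pstar \<Longrightarrow> norm (z - xs) < dL \<Longrightarrow> 2 *\<^sub>R z - xs \<in> Pstar"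
    using Pi_set_locally_conical[of xs B l u "x k0"] xsP k0[of k0] by auto
  obtain dc where dc: "dc > 0" "\<And>z. dist z xs < dc \<Longrightarrow> dist (df z) (df xs) < dI / 2"
    using cont_df dI(1) unfolding continuous_on_iff by (metis UNIV_I half_gt_zero)
  \<comment> \<open>On this ball the KL inequality, the gradient estimate and local conicity all
    hold; \<open>dL\<close> is halved since \<open>y k\<close>, a further \<open>norm (d k)\<close>
    away, must stay within \<open>dL\<close>.\<close>
  define \<delta> where "\<delta> = min dU (min dc (dL / 2))"
  have delta: "\<delta> > 0" using dU dc dL by (simp add: \<delta>_def)

  have "eventually (\<lambda>k. norm (v k) + norm (w k) < dI / 2) sequentially"
  proof -
    have "(\<lambda>k. 3/4 * r k + \<Gamma> * norm (d k)) \<longlonglongrightarrow> 3/4 * 0 + \<Gamma> * 0"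
      by (intro tendsto_intros r_lim d_lim)
    from order_tendstoD(2)[OF this, of "dI / 2"] dI(1)
    have "eventually (\<lambda>k. 3/4 * r k + \<Gamma> * norm (d k) < dI / 2) sequentially" by simp
    then show ?thesis using eventually_ge_at_top[of k0]
      by eventually_elim (use vw(2,3) in force)
  qed
  moreover have "eventually (\<lambda>k. norm (d k) < dL / 2) sequentially"
    using order_tendstoD(2)[OF d_lim, of "dL / 2"] dL(1) by simp
  \<comment> \<open>A positive liminf leaves room for a positive constant below the quotient of A3
    for all large indices.\<close>
  moreover obtain c where c: "0 < c" "eventually (\<lambda>k. c < - inner (df (x k) + xi k) (d k)
                     / (norm (df (x k) + xi k) * norm (d k))) sequentially"
  proof -
    obtain c where "0 < ereal c" "ereal c < liminf (\<lambda>k. ereal (- inner (df (x k) + xi k) (y k - x k)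
                     / (norm (df (x k) + xi k) * norm (y k - x k))))"
      using A3 ereal_dense2 by blast
    then show thesis using that[of c] less_LiminfD by (fastforce simp: d_def)
  qed
  moreover have f0: "(\<lambda>k. f (x k) - fs) \<longlonglongrightarrow> 0"
    using tendsto_diff[OF fs(1) tendsto_const[of fs]] by simp
  have "(\<lambda>k. ereal (f (x k) - fs)) \<longlonglongrightarrow> ereal 0" using f0 by simp
  from order_tendstoD(2)[OF this, of eta] kl(1)
  have small: "eventually (\<lambda>k. ereal (f (x k) - fs) < eta) sequentially" by (simp add: zero_ereal_def)
  ultimately have "eventually (\<lambda>k. norm (v k) + norm (w k) < dI / 2 \<and> norm (d k) < dL / 2 \<and>
      c < - inner (df (x k) + xi k) (d k) / (norm (df (x k) + xi k) * norm (d k)) \<and>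
      ereal (f (x k) - fs) < eta \<and> xi k \<in> normal_cone Pstar (x k) \<and> k \<ge> k0) sequentially"
    using A3 eventually_ge_at_top[of k0] by (auto intro!: eventually_conj)
  then obtain K where K: "\<And>k. k \<ge> K \<Longrightarrow> norm (v k) + norm (w k) < dI / 2" "\<And>k. k \<ge> K \<Longrightarrow> norm (d k) < dL / 2"
    "\<And>k. k \<ge> K \<Longrightarrow> c < - inner (df (x k) + xi k) (d k) / (norm (df (x k) + xi k) * norm (d k))"
    "\<And>k. k \<ge> K \<Longrightarrow> ereal (f (x k) - fs) < eta" "\<And>k. k \<ge> K \<Longrightarrow> xi k \<in> normal_cone Pstar (x k)"
    "\<And>k. k \<ge> K \<Longrightarrow> k \<ge> k0"
    unfolding eventually_sequentially by blast

  \<comment> \<open>Length of a step against the decrease of the desingularised values\<close>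
  define Phi where "Phi k = phi (f (x k) - fs)" for k
  have f_gt: "fs < f (x k)" if "k \<ge> k0" for k
    using fs(2)[of "Suc k"] f_strict[OF that] that by simp
  have Phi_pos: "0 \<le> Phi k" if "k \<ge> K" for k
    using kl(4) K(4)[OF that] fs(2)[OF K(6)[OF that]] unfolding Upsilon_def Phi_def by simp
  have Phi_lim: "Phi \<longlonglongrightarrow> 0"
  proof -
    have "continuous_on {s. 0 \<le> s \<and> ereal s < eta} phi" "phi 0 = 0"
      using kl(4) unfolding Upsilon_def by auto
    moreover have "eventually (\<lambda>k. f (x k) - fs \<in> {s. 0 \<le> s \<and> ereal s < eta}) sequentially"
      using K(4,6) fs(2) by (auto simp: eventually_sequentially)
    ultimately show ?thesis
      using continuous_on_tendsto_compose[OF _ f0] kl(1) unfolding Phi_def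
      by (fastforce simp: zero_ereal_def)
  qed
  have Phi_step: "(rho * c) * norm (x (Suc k) - x k) \<le> Phi k - Phi (Suc k)"
    if k: "k \<ge> K" and near: "dist (x k) xs < \<delta>" for k
  proof -
    have k0k: "k \<ge> k0" by (rule K(6)[OF k])
    have near': "norm (x k - xs) < dL / 2" "dist (x k) xs < dc" "x k \<in> U"
      using near dU by (auto simp: \<delta>_def dist_norm norm_minus_commute)
    have ynear: "norm (y k - xs) < dL"
      using norm_triangle_ineq[of "d k" "x k - xs"] near'(1) K(2)[OF k] by (simp add: d_def)
    have xloc: "2 *\<^sub>R x k - xs \<in> Pstar" using dL near'(1) xP[OF k0k] by simp
    have yloc: "2 *\<^sub>R y k - xs \<in> Pstar" by (rule dL(2)[OF yP[OF k0k] ynear])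
    have xiN: "xi k \<in> normal_cone Pstar xs" "inner (xi k) (x k - xs) = 0"
      by (rule normal_cone_near[OF xloc xsP K(5)[OF k]])+
    \<comment> \<open>The three perturbations of \<open>- df xs\<close>, namely \<open>v k\<close>,
      \<open>w k\<close> and the change of the gradient, add up to less than \<open>dI\<close>, so
      the face identification applies at \<open>y k\<close>.\<close>
    have "norm (v k - df (x k) - w k - - df xs) < dI"
    proof -
      have "v k - df (x k) - w k - - df xs = (v k - w k) - (df (x k) - df xs)" by simp
      then have "norm (v k - df (x k) - w k - - df xs) \<le> norm (v k - w k) + norm (df (x k) - df xs)"
        by (simp only: norm_triangle_ineq4)
      moreover have "norm (v k - w k) \<le> norm (v k) + norm (w k)" by (rule norm_triangle_ineq4)
      ultimately show ?thesis using K(1)[OF k] dc(2)[OF near'(2)] by (simp add: dist_norm)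
    qed
    from dI(2)[OF yP[OF k0k] yloc vw(1)[OF k0k] this xiN(1)]
    have "inner (xi k) (y k - xs) = 0" .
    then have xid: "inner (xi k) (d k) = 0" using xiN(2) by (simp add: d_def inner_diff_right)
    define g where "g = df (x k) + xi k"
    have gd: "- inner g (d k) = - inner (df (x k)) (d k)" using xid by (simp add: g_def inner_add_left)
    \<comment> \<open>With a zero denominator the quotient would be 0, contradicting its lower bound
      \<open>c > 0\<close>.\<close>
    have "norm g * norm (d k) \<noteq> 0" using K(3)[OF k] c(1) unfolding g_def by auto
    then have "norm g * norm (d k) > 0" by (simp add: less_le)
    then have angle: "c * (norm g * norm (d k)) \<le> - inner g (d k)"
      using K(3)[OF k] unfolding g_def[symmetric] by (simp add: field_simps)
    have "rho * al k * (c * (norm g * norm (d k))) \<le> rho * al k * (- inner g (d k))"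
      using angle al[of k] par by (intro mult_left_mono) auto
    then have dec: "(rho * c) * (norm g * norm (x (Suc k) - x k)) \<le> f (x k) - f (x (Suc k))"
      using f_dec[OF k0k] al[of k] unfolding gd step[OF k0k] by (simp add: mult_ac)
    let ?s = "f (x k) - fs" and ?s' = "f (x (Suc k)) - fs"
    have s: "0 < ?s" "ereal ?s < eta" using f_gt[OF k0k] K(4)[OF k] by auto
    have s': "0 \<le> ?s'" "ereal ?s' < eta" using f_gt[of "Suc k"] k0k K(4)[of "Suc k"] k by auto
    have dphi_pos: "dphi ?s > 0" using kl(4) s unfolding Upsilon_def by blast
    have gsub: "g \<in> limiting_subdiff ?h (x k)" using K(5)[OF k] by (simp add: sub g_def)
    have "1 \<le> dphi (real_of_ereal (?h (x k) - ?h xs)) * infdist 0 (limiting_subdiff ?h (x k))"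
    proof (rule kl(5)[OF near'(3)])
      show "?h xs < ?h (x k)" using xsP xP[OF k0k] f_gt[OF k0k] by (simp add: fxs)
      show "?h (x k) < ?h xs + eta"
        using xsP xP[OF k0k] s kl(1) by (cases eta) (auto simp: fxs)
    qed (use gsub in blast)
    also have "real_of_ereal (?h (x k) - ?h xs) = ?s" using xsP xP[OF k0k] by (simp add: fxs)
    also have "dphi ?s * infdist 0 (limiting_subdiff ?h (x k)) \<le> dphi ?s * norm g"
      using infdist_le[OF gsub, of 0] dphi_pos by simp
    \<comment> \<open>The vector \<open>g\<close> is one subgradient of the restricted function at
      \<open>x k\<close>, so its norm bounds the distance in the KL inequality from above.\<close>
    finally have one: "1 \<le> dphi ?s * norm g" .
    have "(rho * c) * norm (x (Suc k) - x k) * 1 \<le> (rho * c) * norm (x (Suc k) - x k) * (dphi ?s * norm g)"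
      using one c(1) par by (intro mult_left_mono) auto
    also have "\<dots> = dphi ?s * ((rho * c) * (norm g * norm (x (Suc k) - x k)))" by simp
    also have "\<dots> \<le> dphi ?s * (?s - ?s')" using dec dphi_pos by simp
    also have "\<dots> \<le> Phi k - Phi (Suc k)"
      unfolding Phi_def by (rule Upsilon_tangent[OF kl(4) s'(1) s s'(2)])
    finally show ?thesis by simp
  qed
  have rc: "rho * c > 0" using par c(1) by simp
  note trap = trapping[OF acc delta rc Phi_pos Phi_lim Phi_step]

  \<comment> \<open>L-stationarity of the limit\<close>
  have "L_stationary df B lam1 lam2 l u xs"
    unfolding L_stationary_def
  \<comment> \<open>A single parameter \<open>M\<close> dominates every \<open>mb k\<close>.
    Enlarging the quadratic term of the competitor keeps the inequality, so the limit can be taken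
    even if the \<open>mb k\<close> do not converge.\<close>
  proof (intro exI[of _ M] conjI M)
    show "xs \<in> prox_set B lam1 lam2 l u (1 / M) (xs - (1 / M) *\<^sub>R df xs)"
      unfolding prox_set_iff[OF M]
    proof (intro conjI ballI)
      show "xs \<in> ?S" using xsP PS by blast
      fix z assume z: "z \<in> ?S"
      have le: "inner (df (x k)) (xbar k - x k) + gfin B lam1 lam2 xs
          \<le> inner (df (x k)) (z - x k) + M / 2 * (norm (z - x k))\<^sup>2 + gfin B lam1 lam2 z"
        if k: "k \<ge> k0" for k
      proof -
        have "gfin B lam1 lam2 xs \<le> gfin B lam1 lam2 (xbar k)"
          using xsP lam unfolding k0[OF k, symmetric]
          by (intro gfin_mono) (auto simp: Pi_set_def supp_eq[OF k])
        moreover have "mb k / 2 * (norm (z - x k))\<^sup>2 \<le> M / 2 * (norm (z - x k))\<^sup>2"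
          using mb_max[of k] by (intro mult_right_mono) auto
        moreover have "0 \<le> mb k / 2 * (norm (xbar k - x k))\<^sup>2" using mb_pos[of k] by simp
        moreover have "inner (df (x k)) (xbar k - x k) + mb k / 2 * (norm (xbar k - x k))\<^sup>2 + gfin B lam1 lam2 (xbar k)
            \<le> inner (df (x k)) (z - x k) + mb k / 2 * (norm (z - x k))\<^sup>2 + gfin B lam1 lam2 z"
          using prox[of k] z unfolding prox_set_iff[OF mb_pos] by blast
        ultimately show ?thesis by linarith
      qed
      have dfl: "(\<lambda>k. df (x k)) \<longlonglongrightarrow> df xs"
        using continuous_on_tendsto_compose[OF cont_df trap(2)] by simp
      have xbl: "(\<lambda>k. xbar k - x k) \<longlonglongrightarrow> 0"
      proof (rule Lim_null_comparison)
        have "norm (xbar k - x k) \<le> r k / mumin" for k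
        proof -
          have "mumin * norm (x k - xbar k) \<le> mb k * norm (x k - xbar k)"
            using mb_min[of k] by (intro mult_right_mono) auto
          also have "\<dots> = r k" using mb_pos[of k] by (simp add: r_def)
          finally show ?thesis using par(2) by (simp add: field_simps norm_minus_commute)
        qed
        then show "eventually (\<lambda>k. norm (xbar k - x k) \<le> r k / mumin) sequentially" by simp
        show "(\<lambda>k. r k / mumin) \<longlonglongrightarrow> 0"
          using tendsto_divide[OF r_lim tendsto_const[of mumin]] par by simp
      qed
      have "inner (df xs) 0 + gfin B lam1 lam2 xs
          \<le> inner (df xs) (z - xs) + M / 2 * (norm (z - xs))\<^sup>2 + gfin B lam1 lam2 z"
      proof (rule LIMSEQ_le)
        show "(\<lambda>k. inner (df (x k)) (xbar k - x k) + gfin B lam1 lam2 xs) \<longlonglongrightarrow> inner (df xs) 0 + gfin B lam1 lam2 xs"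
          by (intro tendsto_intros dfl xbl)
        show "(\<lambda>k. inner (df (x k)) (z - x k) + M / 2 * (norm (z - x k))\<^sup>2 + gfin B lam1 lam2 z)
            \<longlonglongrightarrow> inner (df xs) (z - xs) + M / 2 * (norm (z - xs))\<^sup>2 + gfin B lam1 lam2 z"
          by (intro tendsto_intros dfl trap(2))
      qed (use le in blast)
      then show "inner (df xs) (xs - xs) + M / 2 * (norm (xs - xs))\<^sup>2 + gfin B lam1 lam2 xs
          \<le> inner (df xs) (z - xs) + M / 2 * (norm (z - xs))\<^sup>2 + gfin B lam1 lam2 z" by simp
    qed
  qed
  then show ?thesis using trap by blast
qed

end
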